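(* Let $\mathcal H\neq\{0\}$ be a separable Hilbert space, let $\mathbf C\in\mathcal B(\mathcal H)$ be accretive, and let $\mathbf P(t)=e^{-\mathbf C t}$, $t\ge 0$. (a) If $\mathbf C$ has hypocoercivity index $m_{HC}\in\mathbb N_0$, put $a:=2m_{HC}+1$ and $$c:=\frac{\lim_{\delta\to0^+}\Big[\inf\big\{\|\sqrt{\mathbf C_H}\,\mathbf C^{m_{HC}}x\|^2 : x\in\mathbb S,\ \|\sqrt{\mathbf C_H}\,\mathbf C^{j}x\|^2\le\delta\ \ \forall j=0,\dots,m_{HC}-1\big\}\Big]}{(2m_{HC}+1)!\,\binom{2m_{HC}}{m_{HC}}}.$$ Then there exist constants $c_1\ge c\ge c_2>0$, $C_1,C_2\ge0$ and $t_0>0$ such that $$1-c_1t^a-C_1t^{a+1}\le\|\mathbf P(t)\|\le 1-c_2t^a+C_2t^{a+1}\qquad\text{for } t\in[0,t_0],$$ and $$\|\mathbf P(t)\|=1-ct^a+o(t^a)\qquad\text{for } t\to0^+.$$ (b) Conversely, if there are real constants $c>0$ and $a>0$ such that $\|\mathbf P(t)\|=1-ct^a+o(t^a)$ for $t\to0^+$, then $a$ is an odd integer and $\mathbf C$ is hypocoercive with hypocoercivity index $m_{HC}=\frac{a-1}{2}\in\mathbb N_0$.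
   Context: $\mathcal B(\mathcal H)$ is the space of bounded linear operators on $\mathcal H$; $\|\mathbf P(t)\|$ is the operator norm; $\mathbb S=\{x\in\mathcal H:\|x\|=1\}$. For $\mathbf C\in\mathcal B(\mathcal H)$, $\mathbf C_H=(\mathbf C+\mathbf C^* )/2$. $\mathbf C$ is accretive if $\operatorname{Re}\langle\mathbf Cx,x\rangle\ge0$ for all $x$, i.e. $\mathbf C_H\ge0$; then $\sqrt{\mathbf C_H}$ is its unique nonnegative self-adjoint square root. For accretive $\mathbf C\in\mathcal B(\mathcal H)$, the hypocoercivity index $m_{HC}$ of $\mathbf C$ is the smallest integer $m\in\mathbb N_0$ (if it exists) such that $\sum_{j=0}^m(\mathbf C^* )^j\mathbf C_H\mathbf C^j\ge\kappa\mathbf I$ for some $\kappa>0$. $\mathbf C\in\mathcal B(\mathcal H)$ is hypocoercive if $(e^{-\mathbf Ct})_{t\ge0}$ is uniformly exponentially stable, i.e. there exist $M<\infty$ and $\lambda>0$ with $\|e^{-\mathbf Ct}\|\le Me^{-\lambda t}$ for all $t\ge0$. *)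

theory Defs
  imports "HOL-Analysis.Analysis"
begin

section \<open>Complex Hilbert spaces\<close>

text \<open>
  The inner product is linear in its first and antilinear in its second argument.
  Since the norm of a normed space is nonnegative and definite, the last axiom of
  \<open>complex_inner\<close> also says that the inner product is positive definite.
\<close>

class complex_inner = real_normed_vector +
  fixes scaleC :: "complex \<Rightarrow> 'a \<Rightarrow> 'a" (infixr \<open>*\<^sub>C\<close> 75)
    and cinner :: "'a \<Rightarrow> 'a \<Rightarrow> complex"
  assumes scaleC_add_right: "c *\<^sub>C (x + y) = c *\<^sub>C x + c *\<^sub>C y"
    and scaleC_add_left: "(c + d) *\<^sub>C x = c *\<^sub>C x + d *\<^sub>C x"
    and scaleC_scaleC: "c *\<^sub>C (d *\<^sub>C x) = (c * d) *\<^sub>C x"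
    and scaleR_scaleC: "r *\<^sub>R x = complex_of_real r *\<^sub>C x"
    and cinner_commute: "cinner x y = cnj (cinner y x)"
    and cinner_add_left: "cinner (x + y) z = cinner x z + cinner y z"
    and cinner_scaleC_left: "cinner (c *\<^sub>C x) y = c * cinner x y"
    and cinner_self: "cinner x x = complex_of_real ((norm x)\<^sup>2)"

class complex_hilbert = complex_inner + banach

class nonzero_complex_hilbert = complex_hilbert +
  assumes ex_nonzero: "\<exists>x. x \<noteq> 0"

instantiation complex :: nonzero_complex_hilbert
begin

definition scaleC_complex :: "complex \<Rightarrow> complex \<Rightarrow> complex"
  where "scaleC_complex c x = c * x"

definition cinner_complex :: "complex \<Rightarrow> complex \<Rightarrow> complex"
  where "cinner_complex x y = x * cnj y"

instance
proof
  show "\<exists>x::complex. x \<noteq> 0"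
    by (rule exI[of _ 1]) simp
qed (auto simp: scaleC_complex_def cinner_complex_def algebra_simps scaleR_conv_of_real
      simp flip: complex_norm_square)

end


section \<open>The Banach algebra of bounded complex-linear operators\<close>

text \<open>
  A \<open>blinfun\<close> is only real-linear. The operator norm is the one of \<open>blinfun\<close>. As \<open>'a op\<close> is
  made a unital Banach algebra, powers and the exponential are those of the library.
\<close>

typedef (overloaded) 'a op =
  "{f :: 'a::complex_inner \<Rightarrow>\<^sub>L 'a. \<forall>c x. blinfun_apply f (c *\<^sub>C x) = c *\<^sub>C blinfun_apply f x}"
  morphisms blinfun_of_op Op
proof
  have "c *\<^sub>C (0::'a) = 0" for c
    using scaleC_add_right[of c 0 "0::'a"] by simp
  then show "0 \<in> {f :: 'a \<Rightarrow>\<^sub>L 'a. \<forall>c x. blinfun_apply f (c *\<^sub>C x) = c *\<^sub>C blinfun_apply f x}"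
    by simp
qed

setup_lifting type_definition_op

lift_definition op_apply :: "'a::complex_inner op \<Rightarrow> 'a \<Rightarrow> 'a" (infixr \<open>\<cdot>\<close> 75)
  is blinfun_apply .

lemma op_eqI: "(\<And>x. A \<cdot> x = B \<cdot> x) \<Longrightarrow> A = B"
  by transfer (rule blinfun_eqI)

lemma op_apply_scaleC: "A \<cdot> (c *\<^sub>C x) = c *\<^sub>C (A \<cdot> x)"
  by transfer simp

lemma scaleC_zero_right [simp]: "c *\<^sub>C (0::'a::complex_inner) = 0"
  using scaleC_add_right[of c 0 "0::'a"] by simp

lemma scaleC_minus_right: "c *\<^sub>C (- x :: 'a::complex_inner) = - (c *\<^sub>C x)"
  using scaleC_add_right[of c x "- x"] by (simp add: eq_neg_iff_add_eq_0 add.commute)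

lemma scaleC_diff_right: "c *\<^sub>C (x - y :: 'a::complex_inner) = c *\<^sub>C x - c *\<^sub>C y"
  using scaleC_add_right[of c x "- y"] by (simp add: scaleC_minus_right)

lemma scaleC_scaleR: "c *\<^sub>C (r *\<^sub>R x :: 'a::complex_inner) = r *\<^sub>R (c *\<^sub>C x)"
  by (simp add: scaleR_scaleC scaleC_scaleC mult.commute)

lemma norm_scaleC: "norm (c *\<^sub>C x :: 'a::complex_inner) = norm c * norm x"
proof -
  have "cinner (c *\<^sub>C x) (c *\<^sub>C x) = c * cnj (c * cinner x x)"
    using cinner_commute[of x "c *\<^sub>C x"] by (simp add: cinner_scaleC_left)
  also have "\<dots> = complex_of_real ((norm c * norm x)\<^sup>2)"
    by (simp add: cinner_self power_mult_distrib flip: mult.assoc complex_norm_square[simplified])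
  finally have "(norm (c *\<^sub>C x))\<^sup>2 = (norm c * norm x)\<^sup>2"
    by (simp only: cinner_self of_real_eq_iff)
  then show ?thesis
    by (simp add: power2_eq_iff_nonneg)
qed

lemma bounded_linear_scaleC_right: "bounded_linear (\<lambda>x :: 'a::complex_inner. c *\<^sub>C x)"
  by (rule bounded_linear_intro[where K = "norm c"])
     (simp_all add: scaleC_add_right scaleC_scaleR norm_scaleC)

instantiation op :: (complex_inner) real_normed_vector
begin

lift_definition norm_op :: "'a op \<Rightarrow> real" is norm .

lift_definition zero_op :: "'a op" is 0
  by simp

lift_definition plus_op :: "'a op \<Rightarrow> 'a op \<Rightarrow> 'a op" is "(+)"
  by (simp add: blinfun.add_left scaleC_add_right)

lift_definition minus_op :: "'a op \<Rightarrow> 'a op \<Rightarrow> 'a op" is "(-)"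
  by (simp add: blinfun.diff_left scaleC_diff_right)

lift_definition uminus_op :: "'a op \<Rightarrow> 'a op" is uminus
  by (simp add: blinfun.minus_left scaleC_minus_right)

lift_definition scaleR_op :: "real \<Rightarrow> 'a op \<Rightarrow> 'a op" is "(*\<^sub>R)"
  by (simp add: blinfun.scaleR_left scaleC_scaleR)

definition dist_op :: "'a op \<Rightarrow> 'a op \<Rightarrow> real"
  where "dist_op A B = norm (A - B)"

definition uniformity_op :: "('a op \<times> 'a op) filter"
  where "uniformity_op = (INF e\<in>{0<..}. principal {(A, B). dist A B < e})"

definition open_op :: "'a op set \<Rightarrow> bool"
  where "open_op S = (\<forall>A\<in>S. \<forall>\<^sub>F (A', B) in uniformity. A' = A \<longrightarrow> B \<in> S)"

definition sgn_op :: "'a op \<Rightarrow> 'a op"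
  where "sgn_op A = inverse (norm A) *\<^sub>R A"

instance
  apply standard
  unfolding dist_op_def open_op_def sgn_op_def uniformity_op_def
                  apply (rule refl | (transfer, force simp: algebra_simps norm_triangle_ineq))+
  done

end

lemma blinfun_of_op_scaleC:
  "blinfun_apply (blinfun_of_op A) (c *\<^sub>C x) = c *\<^sub>C blinfun_apply (blinfun_of_op A) x"
  using op_apply_scaleC[of A c x] by (simp add: op_apply.rep_eq)

lemma norm_blinfun_of_op: "norm (blinfun_of_op A) = norm A"
  by transfer simp

instance op :: (complex_hilbert) banach
proof
  fix X :: "nat \<Rightarrow> 'a op"
  assume X: "Cauchy X"
  let ?Y = "\<lambda>n. blinfun_of_op (X n)"
  have diff: "dist (blinfun_of_op A) (blinfun_of_op B) = dist A B" for A B :: "'a op"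
    by (simp add: dist_norm flip: minus_op.rep_eq norm_blinfun_of_op)
  have "Cauchy ?Y"
    using X by (simp add: Cauchy_def diff)
  then obtain F where F: "?Y \<longlonglongrightarrow> F"
    by (auto simp: Cauchy_convergent_iff convergent_def)
  have lim: "(\<lambda>n. blinfun_apply (?Y n) x) \<longlonglongrightarrow> blinfun_apply F x" for x
    by (intro tendsto_intros F)
  have "blinfun_apply F (c *\<^sub>C x) = c *\<^sub>C blinfun_apply F x" for c x
  proof (rule LIMSEQ_unique[OF lim])
    have "(\<lambda>n. c *\<^sub>C blinfun_apply (?Y n) x) \<longlonglongrightarrow> c *\<^sub>C blinfun_apply F x"
      by (rule bounded_linear.tendsto[OF bounded_linear_scaleC_right lim])
    then show "(\<lambda>n. blinfun_apply (?Y n) (c *\<^sub>C x)) \<longlonglongrightarrow> c *\<^sub>C blinfun_apply F x"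
      by (simp add: blinfun_of_op_scaleC)
  qed
  then have "blinfun_of_op (Op F) = F"
    by (simp add: Op_inverse)
  then have "X \<longlonglongrightarrow> Op F"
    using F by (simp add: tendsto_iff flip: diff)
  then show "convergent X"
    by (auto simp: convergent_def)
qed

instantiation op :: (nonzero_complex_hilbert) real_normed_algebra_1
begin

lift_definition one_op :: "'a op" is id_blinfun
  by simp

lift_definition times_op :: "'a op \<Rightarrow> 'a op \<Rightarrow> 'a op" is "(o\<^sub>L)"
  by simp

instance
proof
  fix A B D :: "'a op" and r :: real
  show "A * B * D = A * (B * D)"
    by transfer (simp add: blinfun_eqI)
  show "(A + B) * D = A * D + B * D" "A * (B + D) = A * B + A * D"
    by (transfer, simp add: blinfun_eqI blinfun.bilinear_simps)+
  show "r *\<^sub>R A * B = r *\<^sub>R (A * B)" "A * r *\<^sub>R B = r *\<^sub>R (A * B)"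
    by (transfer, simp add: blinfun_eqI blinfun.bilinear_simps)+
  show "1 * A = A" "A * 1 = A"
    by (transfer, simp add: blinfun_eqI)+
  show "norm (A * B) \<le> norm A * norm B"
    by transfer (rule norm_blinfun_compose)
  obtain x :: 'a where x: "x \<noteq> 0"
    using ex_nonzero by blast
  have "norm (id_blinfun :: 'a \<Rightarrow>\<^sub>L 'a) = 1"
    using x by (intro norm_blinfun_eqI[where x = x]) auto
  then show "norm (1 :: 'a op) = 1"
    by transfer
  then show "(0 :: 'a op) \<noteq> 1"
    using norm_zero by (metis zero_neq_one)
qed

end

lemma op_apply_simps:
  "1 \<cdot> x = x" "(A * B) \<cdot> x = A \<cdot> B \<cdot> x" "(A + B) \<cdot> x = A \<cdot> x + B \<cdot> x"
  "(A - B) \<cdot> x = A \<cdot> x - B \<cdot> x" "(r *\<^sub>R A) \<cdot> x = r *\<^sub>R (A \<cdot> x)"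
  for A B :: "'a::nonzero_complex_hilbert op"
  by (transfer, simp add: blinfun.bilinear_simps)+


section \<open>Hypocoercivity\<close>

text \<open>
  The descriptions in \<open>adj\<close> and \<open>sqrt_op\<close> are well defined: the adjoint exists uniquely by
  Riesz representation, the square root exists uniquely if \<open>A\<close> is nonnegative.
\<close>

definition adj :: "'a::nonzero_complex_hilbert op \<Rightarrow> 'a op"
  where "adj A = (THE B. \<forall>x y. cinner (A \<cdot> x) y = cinner x (B \<cdot> y))"

definition nonneg_op :: "'a::nonzero_complex_hilbert op \<Rightarrow> bool"
  where "nonneg_op A \<longleftrightarrow> adj A = A \<and> (\<forall>x. 0 \<le> Re (cinner (A \<cdot> x) x))"

definition op_le :: "'a::nonzero_complex_hilbert op \<Rightarrow> 'a op \<Rightarrow> bool"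
  where "op_le A B \<longleftrightarrow> nonneg_op (B - A)"

definition sqrt_op :: "'a::nonzero_complex_hilbert op \<Rightarrow> 'a op"
  where "sqrt_op A = (THE B. nonneg_op B \<and> B * B = A)"

definition herm :: "'a::nonzero_complex_hilbert op \<Rightarrow> 'a op"
  where "herm C = (1/2) *\<^sub>R (C + adj C)"

definition accretive :: "'a::nonzero_complex_hilbert op \<Rightarrow> bool"
  where "accretive C \<longleftrightarrow> (\<forall>x. 0 \<le> Re (cinner (C \<cdot> x) x))"

definition hc_coercive :: "'a::nonzero_complex_hilbert op \<Rightarrow> nat \<Rightarrow> bool"
  where "hc_coercive C m \<longleftrightarrow>
    (\<exists>\<kappa>>0. op_le (\<kappa> *\<^sub>R 1) (\<Sum>j=0..m. adj C ^ j * herm C * C ^ j))"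

text \<open>A relation rather than a function, since the index need not exist.\<close>

definition has_hc_index :: "'a::nonzero_complex_hilbert op \<Rightarrow> nat \<Rightarrow> bool"
  where "has_hc_index C m \<longleftrightarrow> hc_coercive C m \<and> (\<forall>k<m. \<not> hc_coercive C k)"

definition hypocoercive :: "'a::nonzero_complex_hilbert op \<Rightarrow> bool"
  where "hypocoercive C \<longleftrightarrow>
    (\<exists>M \<omega>::real. \<omega> > 0 \<and> (\<forall>t\<ge>0. norm (exp (- (t *\<^sub>R C))) \<le> M * exp (- \<omega> * t)))"

text \<open>
  If \<open>m\<close> is the hypocoercivity index, then for every \<open>\<delta> > 0\<close> the set below is nonempty (by
  minimality of \<open>m\<close>), so \<open>Inf\<close> is a genuine infimum; it is antitone in \<open>\<delta>\<close> and bounded, so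
  the limit in \<open>hc_const\<close> exists.
\<close>

definition hc_inf :: "'a::nonzero_complex_hilbert op \<Rightarrow> nat \<Rightarrow> real \<Rightarrow> real"
  where "hc_inf C m \<delta> =
    Inf {(norm ((sqrt_op (herm C) * C ^ m) \<cdot> x))\<^sup>2 | x.
      norm x = 1 \<and> (\<forall>j<m. (norm ((sqrt_op (herm C) * C ^ j) \<cdot> x))\<^sup>2 \<le> \<delta>)}"

definition hc_const :: "'a::nonzero_complex_hilbert op \<Rightarrow> nat \<Rightarrow> real"
  where "hc_const C m =
    Lim (at_right 0) (hc_inf C m) / (fact (2 * m + 1) * real ((2 * m) choose m))"

end

theory Submission
  imports Defs
begin

text \<open>
  Write \<open>R\<close> for the square root of \<open>C\<^sub>H\<close> and \<open>P(t)\<close> for \<open>exp (-tC)\<close>. Along an orbit the energy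
  decays by \<open>d/dt \<parallel>P(t) x\<parallel>\<^sup>2 = - 2 \<parallel>R P(t) x\<parallel>\<^sup>2\<close>. Hence the loss \<open>(\<parallel>x\<parallel>\<^sup>2 - \<parallel>P(t) x\<parallel>\<^sup>2) / 2\<close> is the
  integral of \<open>\<parallel>R P(s) x\<parallel>\<^sup>2\<close> over \<open>[0, t]\<close>, and \<open>1 - \<parallel>P(t)\<parallel>\<^sup>2\<close> is twice the infimum of this loss
  over all unit vectors \<open>x\<close>. Up to an error \<open>O(s\<^bsup>m+1\<^esup>)\<close> the function \<open>R P(s) x\<close> is the polynomial
  with the vector coefficients \<open>(-1)\<^sup>j R C\<^sup>j x / j!\<close>. The question is therefore how small the
  \<open>L\<^sup>2\<close> norm on \<open>[0, t]\<close> of such a polynomial can be.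

  A polynomial of degree \<open>m\<close> on \<open>[0, 1]\<close> with leading coefficient \<open>v\<close> has squared norm at least
  \<open>\<parallel>v\<parallel>\<^sup>2\<close> times that of the monic Legendre polynomial. Rescaled to \<open>[0, t]\<close>, with
  \<open>v = R C\<^sup>m x / m!\<close>, this is exactly the factor \<open>t\<^bsup>2m+1\<^esup> / ((2m+1)! (2m choose m))\<close> of \<open>\<parallel>R C\<^sup>m x\<parallel>\<^sup>2\<close>
  (\<open>energy_loss_lower_bound\<close>). The same estimate in a degree \<open>j < m\<close> shows that a vector with
  \<open>\<parallel>R C\<^sup>j x\<parallel>\<^sup>2 > \<delta>\<close> loses energy of order \<open>t\<^bsup>2j+1\<^esup>\<close>, which is far more than \<open>t\<^bsup>2m+1\<^esup>\<close>. So for small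
  \<open>t\<close> only vectors compete for which all lower terms are at most \<open>\<delta>\<close>. This is where
  the infimum in the constant comes from, and it gives the upper estimate of \<open>\<parallel>P(t)\<parallel>\<close>.

  For the lower estimate of \<open>\<parallel>P(t)\<parallel>\<close> the Legendre polynomial has to be attained. Given a unit
  vector \<open>x\<close> whose lower terms are at most \<open>t\<^bsup>2m+2\<^esup>\<close>, the corrected vector
  \<open>y = \<Sum>\<^sub>k a\<^sub>k t\<^sup>k C\<^sup>k x\<close> satisfies \<open>R C\<^bsup>m-k\<^esup> y = a\<^sub>k t\<^sup>k R C\<^sup>m x + O(t\<^bsup>k+1\<^esup>)\<close>. The numbers \<open>a\<^sub>k\<close> can
  be chosen so that \<open>R P(s) y\<close> becomes a multiple of the rescaled Legendre polynomial, up to an error \<open>O(t\<^bsup>m+1\<^esup>)\<close>, while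
  \<open>a\<^sub>0 = 1\<close> keeps the norm of \<open>y\<close> at \<open>1 + O(t)\<close> (\<open>energy_loss_corrected\<close>). Together the two
  estimates give \<open>(1 - \<parallel>P(t)\<parallel>) / t\<^bsup>2m+1\<^esup> \<longrightarrow> c\<close> (\<open>evolution_defect_tendsto\<close>). The two-sided bounds
  of part (a) follow at once, with \<open>c\<^sub>1 = 2c\<close>, \<open>c\<^sub>2 = c/2\<close> and \<open>C\<^sub>1 = C\<^sub>2 = 0\<close>.

  For part (b), if no index existed then \<open>R C\<^sup>j x\<close> could be made small for all \<open>j \<le> m\<close> at once,
  for every \<open>m\<close>. The corrected vectors would then show that \<open>1 - \<parallel>P(t)\<parallel>\<close> vanishes faster than any power of
  \<open>t\<close> (\<open>ex_hc_coercive\<close>). So there is an index, and part (a) forces the exponents to agree.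
  Finally, \<open>\<parallel>P(t)\<parallel> < 1\<close> for a single \<open>t > 0\<close> implies exponential stability.

  All of this presupposes that adjoints and nonnegative square roots, which are introduced by
  definite descriptions, exist. The adjoint comes from the Riesz representation, the square root
  from the binomial series of \<open>sqrt (1 - z)\<close> in the Banach algebra of operators.
\<close>

section \<open>The real inner product and Riesz representation\<close>

text \<open>
  As complex-linear maps are determined by the real part of the inner product, everything
  below is done in the underlying real Hilbert space.
\<close>

definition rinner :: "'a::complex_inner \<Rightarrow> 'a \<Rightarrow> real"
  where "rinner x y = Re (cinner x y)"

lemma rinner_commute: "rinner x y = rinner y x"
  unfolding rinner_def by (subst cinner_commute) simp

lemma rinner_self: "rinner x x = (norm x)\<^sup>2"
  by (simp add: rinner_def cinner_self)

lemma rinner_add_left: "rinner (x + y) z = rinner x z + rinner y z"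
  by (simp add: rinner_def cinner_add_left)

lemma rinner_scaleR_left: "rinner (r *\<^sub>R x) y = r * rinner x y"
  by (simp add: rinner_def scaleR_scaleC cinner_scaleC_left)

lemma rinner_add_right: "rinner z (x + y) = rinner z x + rinner z y"
  by (metis rinner_add_left rinner_commute)

lemma rinner_scaleR_right: "rinner x (r *\<^sub>R y) = r * rinner x y"
  by (metis rinner_scaleR_left rinner_commute)

lemma norm_add_power2: "(norm (x + y))\<^sup>2 = (norm x)\<^sup>2 + 2 * rinner x y + (norm y)\<^sup>2"
  by (simp add: rinner_add_left rinner_add_right rinner_commute[of y x] flip: rinner_self)

lemma rinner_le_norm: "rinner x y \<le> norm x * norm y"
proof -
  \<comment> \<open>Here Cauchy-Schwarz is the triangle inequality, as the norm is already known to be one.\<close>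
  have "(norm (x + y))\<^sup>2 \<le> (norm x + norm y)\<^sup>2"
    by (intro power_mono norm_triangle_ineq norm_ge_zero)
  then show ?thesis
    by (simp add: norm_add_power2 power2_sum)
qed

lemma abs_rinner_le_norm: "\<bar>rinner x y\<bar> \<le> norm x * norm y"
  using rinner_le_norm[of x y] rinner_le_norm[of "- x" y] rinner_scaleR_left[of "-1" x y]
  by (simp add: abs_le_iff)

lemma bounded_bilinear_rinner: "bounded_bilinear rinner"
proof
  show "\<exists>K. \<forall>a b. norm (rinner a b) \<le> norm a * norm b * K"
    by (intro exI[of _ 1]) (simp add: abs_rinner_le_norm)
qed (simp_all add: rinner_add_left rinner_add_right rinner_scaleR_left rinner_scaleR_right)

interpretation rinner: bounded_bilinear rinner
  by (rule bounded_bilinear_rinner)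

lemma cinner_conv_rinner: "cinner x y = Complex (rinner x y) (- rinner (\<i> *\<^sub>C x) y)"
  by (simp add: rinner_def cinner_scaleC_left complex_eq_iff)

lemma parallelogram: "(norm (x - y))\<^sup>2 + (norm (x + y))\<^sup>2 = 2 * (norm x)\<^sup>2 + 2 * (norm y)\<^sup>2"
  for x y :: "'a::complex_inner"
  using norm_add_power2[of x y] norm_add_power2[of x "- y"] by (simp add: rinner.minus_right)

text \<open>
  The representing vector is the minimiser of \<open>J x = \<parallel>x\<parallel>\<^sup>2 - 2 \<phi> x\<close>: the parallelogram identity
  makes every minimising sequence a Cauchy sequence, and at a minimum the derivative of \<open>J\<close>
  vanishes in each direction.
\<close>

lemma riesz_representation:
  fixes \<phi> :: "'a::complex_hilbert \<Rightarrow> real"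
  assumes "bounded_linear \<phi>"
  obtains z where "\<And>x. \<phi> x = rinner x z"
proof -
  interpret \<phi>: bounded_linear \<phi> by fact
  define J where "J x = (norm x)\<^sup>2 - 2 * \<phi> x" for x
  define d where "d = Inf (range J)"
  obtain K where K: "\<And>x. \<bar>\<phi> x\<bar> \<le> norm x * K"
    using \<phi>.bounded by auto
  have "- K\<^sup>2 \<le> J x" for x
  proof -
    have "0 \<le> (norm x - K)\<^sup>2" by simp
    then show ?thesis
      using K[of x] by (simp add: J_def power2_diff)
  qed
  then have bdd: "bdd_below (range J)"
    by (auto intro!: bdd_belowI)
  have d_le: "d \<le> J x" for x
    unfolding d_def by (rule cInf_lower[OF _ bdd]) simp
  have "\<exists>x. J x < d + 1 / Suc n" for n
    using cInf_lessD[of "range J" "d + 1 / Suc n"] by (auto simp flip: d_def)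
  then obtain X where X: "\<And>n. J (X n) < d + 1 / Suc n"
    by metis
  have dist: "(norm (x - y))\<^sup>2 \<le> 2 * (J x - d) + 2 * (J y - d)" for x y
  proof -
    have "J ((1/2) *\<^sub>R (x + y)) = (norm (x + y))\<^sup>2 / 4 - (\<phi> x + \<phi> y)"
      by (simp add: J_def \<phi>.scaleR \<phi>.add power_divide add_divide_distrib del: scaleR_add_right)
    then show ?thesis
      using parallelogram[of x y] d_le[of "(1/2) *\<^sub>R (x + y)"] unfolding J_def by argo
  qed
  have "Cauchy X"
  proof (rule CauchyI)
    fix e :: real
    assume "e > 0"
    then obtain M where M: "4 / e\<^sup>2 < real (Suc M)"
      using reals_Archimedean2 by (metis less_trans of_nat_less_iff lessI)
    have "norm (X m - X n) < e" if "m \<ge> M" "n \<ge> M" for m n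
    proof -
      have *: "J (X k) - d < e\<^sup>2 / 4" if "k \<ge> M" for k
      proof -
        have "1 / Suc k \<le> 1 / Suc M"
          using that by (simp add: field_simps)
        also have "\<dots> < e\<^sup>2 / 4"
          using M \<open>e > 0\<close> by (simp add: field_simps)
        finally show ?thesis
          using X[of k] by linarith
      qed
      have "(norm (X m - X n))\<^sup>2 < e\<^sup>2"
        using dist[of "X m" "X n"] *[OF that(1)] *[OF that(2)] by argo
      then show ?thesis
        using \<open>e > 0\<close> by (simp add: power_less_imp_less_base)
    qed
    then show "\<exists>M. \<forall>m\<ge>M. \<forall>n\<ge>M. norm (X m - X n) < e"
      by blast
  qed
  then obtain z where z: "X \<longlonglongrightarrow> z"
    by (auto simp: Cauchy_convergent_iff convergent_def)
  have "(\<lambda>n. J (X n)) \<longlonglongrightarrow> J z"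
    unfolding J_def by (intro tendsto_intros z \<phi>.tendsto)
  moreover have "(\<lambda>n. d + 1 / Suc n) \<longlonglongrightarrow> d + 0"
    by (intro tendsto_intros LIMSEQ_Suc[OF lim_1_over_n])
  ultimately have "J z \<le> d + 0"
    using X by (intro LIMSEQ_le) (auto intro: less_imp_le)
  then have Jz: "J z \<le> J x" for x
    using d_le[of x] by simp
  have "\<phi> x = rinner x z" for x
  proof -
    define b where "b = rinner x z - \<phi> x"
    \<comment> \<open>A quadratic in \<open>s\<close> with a zero at \<open>s = 0\<close> stays nonnegative only if its linear coefficient \<open>b\<close> vanishes.\<close>
    have quad: "0 \<le> 2 * s * b + s\<^sup>2 * (norm x)\<^sup>2" for s
      using Jz[of "z + s *\<^sub>R x"] norm_add_power2[of z "s *\<^sub>R x"]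
      by (simp add: J_def b_def \<phi>.add \<phi>.scaleR rinner.scaleR_right rinner_commute
          power_mult_distrib algebra_simps)
    have "b\<^sup>2 \<le> 0"
    proof (cases "x = 0")
      case True
      then show ?thesis by (simp add: b_def rinner.zero_left \<phi>.zero)
    next
      case False
      then have "2 * (- b / (norm x)\<^sup>2) * b + (- b / (norm x)\<^sup>2)\<^sup>2 * (norm x)\<^sup>2 = - (b\<^sup>2 / (norm x)\<^sup>2)"
        by (simp add: field_simps power2_eq_square)
      then show ?thesis
        using quad[of "- b / (norm x)\<^sup>2"] False by (simp add: field_simps)
    qed
    then show ?thesis
      by (simp add: b_def)
  qed
  then show ?thesis by (rule that)
qed


section \<open>Adjoints\<close>

lemma norm_op_apply_le: "norm (A \<cdot> x) \<le> norm A * norm x"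
  by transfer (rule norm_blinfun)

lemma bounded_bilinear_op_apply: "bounded_bilinear ((\<cdot>) :: 'a::complex_inner op \<Rightarrow> _)"
proof
  show "\<exists>K. \<forall>(A :: 'a op) x. norm (A \<cdot> x) \<le> norm A * norm x * K"
    by (intro exI[of _ 1]) (simp add: norm_op_apply_le)
qed (transfer, simp add: blinfun.bilinear_simps)+

interpretation op_apply: bounded_bilinear "(\<cdot>)"
  by (rule bounded_bilinear_op_apply)

lemma op_norm_le:
  assumes "0 \<le> b" and "\<And>x. norm x = 1 \<Longrightarrow> norm (A \<cdot> x) \<le> b"
  shows "norm A \<le> b"
proof -
  have "norm (A \<cdot> x) \<le> b * norm x" for x
  proof (cases "x = 0")
    case True
    then show ?thesis by (simp add: op_apply.zero_right)
  next
    case False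
    then have "norm (A \<cdot> (inverse (norm x) *\<^sub>R x)) \<le> b"
      by (intro assms) simp
    then show ?thesis
      using False by (simp add: op_apply.scaleR_right field_simps)
  qed
  with \<open>0 \<le> b\<close> show ?thesis
    by transfer (rule norm_blinfun_bound)
qed

text \<open>
  The imaginary part of the complex inner product is minus the real inner product with \<open>\<i> x\<close>
  in place of \<open>x\<close>, and \<open>A\<close> commutes with \<open>\<i>\<close>.
\<close>

lemma cinner_eqI_rinner:
  assumes "\<And>x. rinner (A \<cdot> x) y = rinner x z"
  shows "cinner (A \<cdot> x) y = cinner x z"
  using assms by (simp add: cinner_conv_rinner flip: op_apply_scaleC)

lemma ex_bounded_linear_op:
  assumes add: "\<And>x y. f (x + y) = f x + f y"
    and scaleC: "\<And>c x. f (c *\<^sub>C x) = c *\<^sub>C f x"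
    and bound: "\<And>x. norm (f x) \<le> K * norm x"
  obtains B :: "'a::nonzero_complex_hilbert op" where "\<And>x. B \<cdot> x = f x"
proof -
  have "bounded_linear f"
    by (rule bounded_linear_intro[where K = K])
      (use assms in \<open>simp_all add: scaleR_scaleC mult.commute\<close>)
  then have "blinfun_apply (Blinfun f) = f"
    by (rule bounded_linear_Blinfun_apply)
  then have "Op (Blinfun f) \<cdot> x = f x" for x
    by (simp add: op_apply.rep_eq Op_inverse scaleC)
  then show ?thesis by (rule that)
qed

lemma rinner_ext:
  assumes "\<And>x. rinner x y = rinner x z"
  shows "y = z"
proof -
  have "rinner (y - z) (y - z) = 0"
    using assms[of "y - z"] by (simp only: rinner.diff_right)
  then show ?thesis
    by (simp add: rinner_self)
qed

lemma ex_adjoint: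
  fixes A :: "'a::nonzero_complex_hilbert op"
  obtains B where "\<And>x y. cinner (A \<cdot> x) y = cinner x (B \<cdot> y)"
proof -
  have "\<exists>z. \<forall>x. rinner (A \<cdot> x) y = rinner x z" for y
    by (rule riesz_representation[OF
          bounded_linear_compose[OF rinner.bounded_linear_left op_apply.bounded_linear_right]]) blast
  then obtain f where f: "\<And>x y. rinner (A \<cdot> x) y = rinner x (f y)"
    by metis
  have fc: "cinner (A \<cdot> x) y = cinner x (f y)" for x y
    by (rule cinner_eqI_rinner) (rule f)
  have "norm (f x) \<le> norm A * norm x" for x
  proof -
    have "(norm (f x))\<^sup>2 \<le> norm (A \<cdot> f x) * norm x"
      using rinner_le_norm[of "A \<cdot> f x" x] by (simp add: f rinner_self)
    also have "\<dots> \<le> norm A * norm (f x) * norm x"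
      by (intro mult_right_mono norm_op_apply_le) simp
    finally show ?thesis
      by (cases "norm (f x) = 0") (simp_all add: power2_eq_square)
  qed
  moreover have "f (x + y) = f x + f y" for x y
    by (rule rinner_ext) (simp add: rinner_add_right flip: f)
  moreover have "f (c *\<^sub>C x) = c *\<^sub>C f x" for c x
  proof (rule rinner_ext)
    fix y
    have "cinner y (f (c *\<^sub>C x)) = cinner y (c *\<^sub>C f x)"
      using fc[of y "c *\<^sub>C x"] fc[of y x]
      by (metis cinner_commute cinner_scaleC_left)
    then show "rinner y (f (c *\<^sub>C x)) = rinner y (c *\<^sub>C f x)"
      by (simp add: rinner_def)
  qed
  ultimately obtain B where "\<And>y. B \<cdot> y = f y"
    using ex_bounded_linear_op by metis
  with fc show ?thesis
    by (intro that[of B]) simp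
qed

text \<open>
  This turns the description defining \<open>adj\<close> into a criterion on the real inner product alone.
\<close>

lemma adj_eqI:
  assumes "\<And>x y. rinner (A \<cdot> x) y = rinner x (B \<cdot> y)"
  shows "adj A = B"
  unfolding adj_def
proof (rule the_equality)
  show "\<forall>x y. cinner (A \<cdot> x) y = cinner x (B \<cdot> y)"
    using cinner_eqI_rinner assms by blast
  fix D
  assume "\<forall>x y. cinner (A \<cdot> x) y = cinner x (D \<cdot> y)"
  then have "rinner x (D \<cdot> y) = rinner x (B \<cdot> y)" for x y
    using assms by (metis rinner_def)
  then show "D = B"
    by (intro op_eqI rinner_ext)
qed

lemma rinner_adj: "rinner (A \<cdot> x) y = rinner x (adj A \<cdot> y)"
proof -
  obtain B where B: "\<And>x y. cinner (A \<cdot> x) y = cinner x (B \<cdot> y)"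
    using ex_adjoint[of A] by blast
  then have "adj A = B"
    by (intro adj_eqI) (simp add: rinner_def)
  then show ?thesis
    by (simp add: rinner_def B)
qed

lemma self_adjoint_iff: "adj A = A \<longleftrightarrow> (\<forall>x y. rinner (A \<cdot> x) y = rinner x (A \<cdot> y))"
  using rinner_adj adj_eqI by metis


section \<open>Square roots of nonnegative operators\<close>

lemma nonneg_op_iff:
  "nonneg_op A \<longleftrightarrow> (\<forall>x y. rinner (A \<cdot> x) y = rinner x (A \<cdot> y)) \<and> (\<forall>x. 0 \<le> rinner (A \<cdot> x) x)"
  by (simp add: nonneg_op_def self_adjoint_iff rinner_def)

lemma rinner_nonneg_op: "nonneg_op A \<Longrightarrow> 0 \<le> rinner (A \<cdot> x) x"
  by (simp add: nonneg_op_def rinner_def)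

text \<open>
  The form of \<open>A\<close> is nonnegative at \<open>x - s A x\<close>. With \<open>s = 1 / \<parallel>A\<parallel>\<close> this is the claim.
  It serves as the Cauchy-Schwarz inequality for the semidefinite form of \<open>A\<close>.
\<close>

lemma norm_nonneg_op_apply_le:
  assumes "nonneg_op A"
  shows "(norm (A \<cdot> x))\<^sup>2 \<le> norm A * rinner (A \<cdot> x) x"
proof (cases "norm A = 0")
  case True
  then show ?thesis by (simp add: op_apply.zero_left)
next
  case False
  define s where "s = 1 / norm A"
  have s: "s > 0" "s * norm A = 1"
    using False by (simp_all add: s_def)
  have sym: "rinner (A \<cdot> (A \<cdot> x)) x = (norm (A \<cdot> x))\<^sup>2"
    using assms by (simp add: nonneg_op_iff rinner_self)
  have "0 \<le> rinner (A \<cdot> (x - s *\<^sub>R (A \<cdot> x))) (x - s *\<^sub>R (A \<cdot> x))"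
    using assms unfolding nonneg_op_iff by blast
  also have "\<dots> = rinner (A \<cdot> x) x - 2 * s * (norm (A \<cdot> x))\<^sup>2 + s\<^sup>2 * rinner (A \<cdot> (A \<cdot> x)) (A \<cdot> x)"
    by (simp add: op_apply.diff_right op_apply.scaleR_right rinner.diff_left rinner.diff_right
        rinner.scaleR_left rinner.scaleR_right sym rinner_self power2_eq_square algebra_simps)
  also have "\<dots> \<le> rinner (A \<cdot> x) x - 2 * s * (norm (A \<cdot> x))\<^sup>2 + s\<^sup>2 * (norm A * (norm (A \<cdot> x))\<^sup>2)"
  proof -
    have "rinner (A \<cdot> (A \<cdot> x)) (A \<cdot> x) \<le> norm (A \<cdot> (A \<cdot> x)) * norm (A \<cdot> x)"
      by (rule rinner_le_norm)
    also have "\<dots> \<le> norm A * norm (A \<cdot> x) * norm (A \<cdot> x)"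
      by (intro mult_right_mono norm_op_apply_le) simp
    finally show ?thesis
      using s(1) by (auto intro!: mult_left_mono simp: power2_eq_square mult.assoc)
  qed
  also have "s\<^sup>2 * (norm A * (norm (A \<cdot> x))\<^sup>2) = s * (norm (A \<cdot> x))\<^sup>2"
    using s by (simp add: power2_eq_square)
  finally have "s * (norm (A \<cdot> x))\<^sup>2 \<le> rinner (A \<cdot> x) x"
    by simp
  then show ?thesis
    using False by (simp add: s_def field_simps)
qed

lemma nonneg_op_apply_eq_0:
  assumes "nonneg_op A" "rinner (A \<cdot> x) x = 0"
  shows "A \<cdot> x = 0"
  using norm_nonneg_op_apply_le[OF assms(1), of x] assms(2) by simp

text \<open>
  For \<open>y = (B - D) x\<close> the equations give \<open>(B + D) y = 0\<close>. As both forms are nonnegative, \<open>B y\<close> and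
  \<open>D y\<close> vanish, whence \<open>\<parallel>y\<parallel>\<^sup>2 = \<langle>x, (B - D) y\<rangle> = 0\<close>.
\<close>

lemma nonneg_sqrt_unique:
  assumes B: "nonneg_op B" and D: "nonneg_op D" and eq: "B * B = D * D" and comm: "B * D = D * B"
  shows "B = D"
proof (rule op_eqI)
  fix x
  define y where "y = (B - D) \<cdot> x"
  have "(B + D) * (B - D) = 0"
    using eq comm by (simp add: algebra_simps)
  then have "(B + D) \<cdot> y = 0"
    unfolding y_def by (simp add: op_apply.zero_left flip: op_apply_simps)
  then have "rinner (B \<cdot> y) y + rinner (D \<cdot> y) y = 0"
    by (metis op_apply.add_left rinner.add_left rinner.zero_left)
  moreover have "0 \<le> rinner (B \<cdot> y) y" "0 \<le> rinner (D \<cdot> y) y"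
    using B D by (simp_all only: rinner_nonneg_op)
  ultimately have "B \<cdot> y = 0" "D \<cdot> y = 0"
    using B D by (auto intro!: nonneg_op_apply_eq_0)
  have "(norm y)\<^sup>2 = rinner ((B - D) \<cdot> x) y"
    by (simp add: y_def rinner_self)
  also have "\<dots> = rinner x (B \<cdot> y) - rinner x (D \<cdot> y)"
    using B D by (simp add: op_apply.diff_left rinner.diff_left nonneg_op_iff)
  also have "\<dots> = 0"
    by (simp add: \<open>B \<cdot> y = 0\<close> \<open>D \<cdot> y = 0\<close> rinner.zero_right)
  finally show "B \<cdot> x = D \<cdot> x"
    by (simp add: y_def op_apply.diff_left)
qed

text \<open>
  The Taylor coefficients of \<open>sqrt (1 - z)\<close> at \<open>0\<close>.
\<close>

definition sqrt_coeff :: "nat \<Rightarrow> real"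
  where "sqrt_coeff n = (-1) ^ n * ((1/2) gchoose n)"

lemma sqrt_coeff_0: "sqrt_coeff 0 = 1"
  by (simp add: sqrt_coeff_def)

lemma sqrt_coeff_Suc: "sqrt_coeff (Suc n) = sqrt_coeff n * ((real n - 1/2) / (real n + 1))"
  by (simp add: sqrt_coeff_def gbinomial_prod_rev field_simps)

lemma sqrt_coeff_Suc_nonpos: "sqrt_coeff (Suc n) \<le> 0"
proof (induction n)
  case 0
  then show ?case by (simp add: sqrt_coeff_Suc sqrt_coeff_0)
next
  case (Suc n)
  then show ?case
    by (subst sqrt_coeff_Suc) (intro mult_nonpos_nonneg divide_nonneg_nonneg; simp)
qed

lemma sum_sqrt_coeff: "(\<Sum>k\<le>n. sqrt_coeff k) = - 2 * (real n + 1) * sqrt_coeff (Suc n)"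
proof (induction n)
  case 0
  then show ?case by (simp add: sqrt_coeff_Suc sqrt_coeff_0)
next
  case (Suc n)
  have "- 2 * (real (Suc n) + 1) * sqrt_coeff (Suc (Suc n)) = - (2 * real n + 1) * sqrt_coeff (Suc n)"
    by (subst sqrt_coeff_Suc) (simp add: field_simps)
  then show ?case
    using Suc by (simp add: algebra_simps)
qed

text \<open>
  Beyond the first one all coefficients are nonpositive, while the partial sums of all of them are
  nonnegative by the closed form. So their absolute values sum to at most the first one.
\<close>

lemma sum_abs_sqrt_coeff_le: "(\<Sum>k<n. \<bar>sqrt_coeff (Suc k)\<bar>) \<le> 1"
proof -
  have "(\<Sum>k<n. \<bar>sqrt_coeff (Suc k)\<bar>) = - (\<Sum>k<n. sqrt_coeff (Suc k))"
    by (simp add: abs_of_nonpos sqrt_coeff_Suc_nonpos flip: sum_negf)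
  also have "\<dots> = 1 - (\<Sum>k\<le>n. sqrt_coeff k)"
    by (simp add: sum.atMost_shift sqrt_coeff_0)
  also have "\<dots> \<le> 1"
    using sqrt_coeff_Suc_nonpos[of n] unfolding sum_sqrt_coeff by (simp add: mult_nonpos_nonpos)
  finally show ?thesis .
qed

lemma summable_abs_sqrt_coeff: "summable (\<lambda>n. \<bar>sqrt_coeff n\<bar>)"
  unfolding summable_Suc_iff[of "\<lambda>n. \<bar>sqrt_coeff n\<bar>", symmetric]
  by (rule summableI_nonneg_bounded[OF _ sum_abs_sqrt_coeff_le]) simp

text \<open>
  The formal identity \<open>(sqrt (1 - z))\<^sup>2 = 1 - z\<close>, which is Vandermonde's convolution for \<open>1/2 + 1/2\<close>.
\<close>

lemma sqrt_coeff_convolution: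
  "(\<Sum>i\<le>n. sqrt_coeff i * sqrt_coeff (n - i)) = (if n = 0 then 1 else if n = 1 then -1 else 0)"
proof -
  have "(\<Sum>i\<le>n. sqrt_coeff i * sqrt_coeff (n - i))
      = (-1) ^ n * (\<Sum>i\<in>{0..n}. ((1/2) gchoose i) * ((1/2) gchoose (n - i)))"
    unfolding sum_distrib_left atMost_atLeast0
    by (intro sum.cong refl) (auto simp: sqrt_coeff_def simp flip: power_add)
  also have "\<dots> = (-1) ^ n * (1 gchoose n)"
    by (simp add: gbinomial_Vandermonde)
  also have "(1 gchoose n) = real (1 choose n)"
    using binomial_gbinomial[of 1 n, where 'a = real] by simp
  finally show ?thesis
    by (auto simp: binomial_eq_0)
qed

text \<open>
  The binomial series converges absolutely in the Banach algebra, and its value \<open>B\<close> commutes with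
  everything that commutes with \<open>Z\<close>. Nonnegativity holds because the absolute values of the
  nonconstant coefficients sum to at most \<open>1\<close>, so that \<open>\<parallel>B - 1\<parallel> \<le> 1\<close>.
\<close>

lemma ex_sqrt_one_minus:
  fixes Z :: "'a::nonzero_complex_hilbert op"
  assumes Z: "norm Z \<le> 1" and self_adj: "\<And>x y. rinner (Z \<cdot> x) y = rinner x (Z \<cdot> y)"
  obtains B where "nonneg_op B" "B * B = 1 - Z" "\<And>D. D * Z = Z * D \<Longrightarrow> B * D = D * B"
proof -
  define b where "b n = sqrt_coeff n *\<^sub>R Z ^ n" for n
  have norm_Zn: "norm (Z ^ n) \<le> 1" for n
    using norm_power_ineq[of Z n] power_le_one[OF norm_ge_zero Z, of n] by linarith
  have norm_b: "norm (b n) \<le> \<bar>sqrt_coeff n\<bar>" for n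
    using mult_left_mono[OF norm_Zn, of "\<bar>sqrt_coeff n\<bar>"] by (simp add: b_def)
  have summable_norm: "summable (\<lambda>n. norm (b n))"
    by (rule summable_comparison_test'[OF summable_abs_sqrt_coeff, where N = 0]) (simp add: norm_b)
  then have summable_b: "summable b"
    by (rule summable_norm_cancel)
  define B where "B = (\<Sum>n. b n)"
  have sums_B: "b sums B"
    unfolding B_def using summable_b by (rule summable_sums)
  have conv: "(\<Sum>i\<le>n. b i * b (n - i)) = (if n = 0 then 1 else if n = 1 then - Z else 0)" for n
  proof -
    have "(\<Sum>i\<le>n. b i * b (n - i)) = (\<Sum>i\<le>n. (sqrt_coeff i * sqrt_coeff (n - i)) *\<^sub>R Z ^ n)"
      by (intro sum.cong refl) (simp add: b_def flip: power_add)
    also have "\<dots> = (\<Sum>i\<le>n. sqrt_coeff i * sqrt_coeff (n - i)) *\<^sub>R Z ^ n"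
      by (rule scaleR_sum_left[symmetric])
    finally show ?thesis
      by (auto simp: sqrt_coeff_convolution)
  qed
  have "(\<lambda>n. \<Sum>i\<le>n. b i * b (n - i)) sums (B * B)"
    unfolding B_def by (rule Cauchy_product_sums[OF summable_norm summable_norm])
  moreover have "(\<lambda>n. \<Sum>i\<le>n. b i * b (n - i)) sums (\<Sum>n\<in>{0, 1::nat}. if n = 0 then 1 else if n = 1 then - Z else 0)"
    unfolding conv by (rule sums_finite) (auto split: if_splits)
  ultimately have "B * B = (\<Sum>n\<in>{0, 1::nat}. if n = 0 then 1 else if n = 1 then - Z else 0)"
    by (rule sums_unique2)
  then have BB: "B * B = 1 - Z"
    by simp
  have "B * D = D * B" if "D * Z = Z * D" for D
  proof -
    have "Z ^ n * D = D * Z ^ n" for n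
      using that by (simp add: power_commuting_commutes)
    then have "(\<lambda>n. D * b n) = (\<lambda>n. b n * D)"
      by (simp add: b_def)
    then show ?thesis
      using sums_mult[OF sums_B, of D] sums_mult2[OF sums_B, of D] sums_unique2 by metis
  qed
  moreover have "nonneg_op B"
    unfolding nonneg_op_iff
  proof safe
    fix x y
    have "rinner (Z ^ n \<cdot> x) y = rinner x (Z ^ n \<cdot> y)" for n
    proof (induction n arbitrary: x y)
      case (Suc n)
      have "rinner (Z ^ Suc n \<cdot> x) y = rinner x ((Z ^ n * Z) \<cdot> y)"
        using Suc by (simp add: op_apply_simps self_adj)
      then show ?case by (simp add: power_commutes)
    qed (simp add: op_apply_simps)
    then have "rinner (b n \<cdot> x) y = rinner x (b n \<cdot> y)" for n
      by (simp add: b_def op_apply_simps rinner.scaleR_left rinner.scaleR_right)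
    moreover have "(\<lambda>n. rinner (b n \<cdot> x) y) sums rinner (B \<cdot> x) y"
      by (intro bounded_linear.sums[OF rinner.bounded_linear_left]
          bounded_linear.sums[OF op_apply.bounded_linear_left] sums_B)
    moreover have "(\<lambda>n. rinner x (b n \<cdot> y)) sums rinner x (B \<cdot> y)"
      by (intro bounded_linear.sums[OF rinner.bounded_linear_right]
          bounded_linear.sums[OF op_apply.bounded_linear_left] sums_B)
    ultimately show "rinner (B \<cdot> x) y = rinner x (B \<cdot> y)"
      by (simp add: sums_unique2)
  next
    fix x :: 'a
    have "(\<lambda>n. b (Suc n)) sums (B - 1)"
      using sums_Suc_iff[of b "B - 1"] sums_B by (simp add: b_def sqrt_coeff_0)
    moreover have "norm (\<Sum>k<n. b (Suc k)) \<le> 1" for n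
      using sum_norm_le[of "{..<n}" "\<lambda>k. b (Suc k)", OF norm_b] sum_abs_sqrt_coeff_le[of n]
      by linarith
    ultimately have "norm (B - 1) \<le> 1"
      unfolding sums_def by (intro Lim_norm_ubound[OF sequentially_bot]) auto
    then have "norm (B - 1) * norm x * norm x \<le> 1 * norm x * norm x"
      by (intro mult_right_mono) simp_all
    moreover have "\<bar>rinner ((B - 1) \<cdot> x) x\<bar> \<le> norm (B - 1) * norm x * norm x"
      using abs_rinner_le_norm mult_right_mono[OF norm_op_apply_le norm_ge_zero] by (rule order_trans)
    ultimately have "\<bar>rinner ((B - 1) \<cdot> x) x\<bar> \<le> (norm x)\<^sup>2"
      by (simp add: power2_eq_square)
    then show "0 \<le> rinner (B \<cdot> x) x"
      by (simp add: op_apply_simps rinner.diff_left rinner_self)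
  qed
  ultimately show ?thesis
    using BB that by blast
qed

text \<open>
  A small multiple \<open>s A\<close> has the form \<open>1 - Z\<close> with \<open>\<parallel>Z\<parallel> \<le> 1\<close>, so the binomial series provides a square
  root. Every other nonnegative square root commutes with \<open>A\<close>, hence with this one, and the two
  coincide. Thus the description defining \<open>sqrt_op\<close> is met.
\<close>

lemma nonneg_sqrt_op:
  assumes A: "nonneg_op A"
  shows "nonneg_op (sqrt_op A)" and "sqrt_op A * sqrt_op A = A"
proof -
  \<comment> \<open>Adding \<open>1\<close> to the norm covers \<open>A = 0\<close>.\<close>
  define s where "s = 1 / (norm A + 1)"
  have s: "s > 0" "s * norm A \<le> 1"
    using add_nonneg_pos[OF norm_ge_zero[of A] zero_less_one] by (simp_all add: s_def)
  define Z where "Z = 1 - s *\<^sub>R A"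
  have Z_apply: "Z \<cdot> x = x - s *\<^sub>R (A \<cdot> x)" for x
    by (simp add: Z_def op_apply_simps)
  have "norm Z \<le> 1"
  proof (rule op_norm_le)
    fix x :: 'a
    assume "norm x = 1"
    have "s * (s * (norm (A \<cdot> x))\<^sup>2) \<le> s * (s * (norm A * rinner (A \<cdot> x) x))"
      using norm_nonneg_op_apply_le[OF A, of x] s by (intro mult_left_mono) auto
    also have "\<dots> = (s * norm A) * (s * rinner (A \<cdot> x) x)"
      by simp
    also have "\<dots> \<le> 1 * (s * rinner (A \<cdot> x) x)"
      using s rinner_nonneg_op[OF A] by (intro mult_right_mono) auto
    finally have "s\<^sup>2 * (norm (A \<cdot> x))\<^sup>2 \<le> s * rinner (A \<cdot> x) x"
      by (simp add: power2_eq_square)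
    moreover have "(norm (Z \<cdot> x))\<^sup>2 = (norm x)\<^sup>2 - 2 * s * rinner (A \<cdot> x) x + s\<^sup>2 * (norm (A \<cdot> x))\<^sup>2"
      using norm_add_power2[of x "- s *\<^sub>R (A \<cdot> x)"] s
      by (simp add: Z_apply rinner.scaleR_right rinner.minus_right power_mult_distrib
          rinner_commute[of x "A \<cdot> x"])
    moreover have "0 \<le> s * rinner (A \<cdot> x) x"
      using s rinner_nonneg_op[OF A] by (intro mult_nonneg_nonneg) auto
    ultimately have "(norm (Z \<cdot> x))\<^sup>2 \<le> 1\<^sup>2"
      using \<open>norm x = 1\<close> by simp
    then show "norm (Z \<cdot> x) \<le> 1"
      by (rule power2_le_imp_le) simp
  qed simp
  moreover have "rinner (Z \<cdot> x) y = rinner x (Z \<cdot> y)" for x y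
    using A by (simp add: Z_apply nonneg_op_iff rinner.diff_left rinner.diff_right
        rinner.scaleR_left rinner.scaleR_right)
  ultimately obtain B where B: "nonneg_op B" "B * B = 1 - Z" "\<And>D. D * Z = Z * D \<Longrightarrow> B * D = D * B"
    using ex_sqrt_one_minus by metis
  define r where "r = 1 / sqrt s"
  have r: "r > 0" "r * r * s = 1"
    using s by (simp_all add: r_def)
  define R where "R = r *\<^sub>R B"
  have "nonneg_op R"
    unfolding nonneg_op_iff
  proof (intro conjI allI)
    show "rinner (R \<cdot> x) y = rinner x (R \<cdot> y)" for x y
      using B(1) by (simp add: R_def nonneg_op_iff op_apply_simps rinner.scaleR_left rinner.scaleR_right)
    show "0 \<le> rinner (R \<cdot> x) x" for x
      using r(1) rinner_nonneg_op[OF B(1), of x] by (simp add: R_def op_apply_simps rinner.scaleR_left)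
  qed
  have "R * R = (r * r * s) *\<^sub>R A"
    by (simp add: R_def B(2) Z_def)
  with \<open>nonneg_op R\<close> have R: "nonneg_op R" "R * R = A"
    by (simp_all add: r(2))
  have "sqrt_op A = R"
    unfolding sqrt_op_def
  proof (rule the_equality)
    fix D
    assume D: "nonneg_op D \<and> D * D = A"
    then have "D * Z = Z * D"
      by (auto simp: Z_def algebra_simps)
    then have "R * D = D * R"
      using B(3) by (simp add: R_def)
    with D R show "D = R"
      using nonneg_sqrt_unique[of R D] by simp
  qed (use R in simp)
  with R show "nonneg_op (sqrt_op A)" and "sqrt_op A * sqrt_op A = A"
    by simp_all
qed


section \<open>Monic Legendre polynomials on the unit interval\<close>

definition poly_integral :: "real poly \<Rightarrow> real"
  where "poly_integral p = integral {0..1} (poly p)"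

lemma has_integral_poly: "(poly p has_integral poly_integral p) {0..1}"
  unfolding poly_integral_def
  by (intro integrable_integral integrable_continuous_interval continuous_intros)

lemma poly_integral_eqI: "(poly p has_integral I) {0..1} \<Longrightarrow> poly_integral p = I"
  unfolding poly_integral_def by (rule integral_unique)

lemma poly_integral_add: "poly_integral (p + q) = poly_integral p + poly_integral q"
  using has_integral_add[OF has_integral_poly[of p] has_integral_poly[of q]]
  by (intro poly_integral_eqI) (simp add: poly_add[abs_def])

lemma poly_integral_smult: "poly_integral (smult c p) = c * poly_integral p"
  using has_integral_mult_right[OF has_integral_poly[of p], of c]
  by (intro poly_integral_eqI) (simp add: poly_smult[abs_def])

lemma poly_integral_pderiv: "poly_integral (pderiv p) = poly p 1 - poly p 0"
  by (intro poly_integral_eqI fundamental_theorem_of_calculus)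
    (auto simp: has_real_derivative_iff_has_vector_derivative[symmetric]
      intro!: poly_DERIV DERIV_subset[OF poly_DERIV])

lemma poly_integral_pderiv_mult:
  assumes "poly p 0 = 0" "poly p 1 = 0"
  shows "poly_integral (pderiv p * q) = - poly_integral (p * pderiv q)"
proof -
  have "poly_integral (pderiv p * q) + poly_integral (p * pderiv q) = poly_integral (pderiv (p * q))"
    by (simp add: pderiv_mult poly_integral_add algebra_simps flip: poly_integral_add)
  also have "\<dots> = 0"
    using assms by (simp add: poly_integral_pderiv)
  finally show ?thesis by simp
qed

lemma poly_integral_const: "poly_integral [:c:] = c"
  using poly_integral_pderiv[of "[:0, c:]"] by (simp add: pderiv_pCons)

lemma abs_poly_bounded_unit_interval:
  obtains M where "M \<ge> 0" "\<And>\<sigma>. \<lbrakk>0 \<le> \<sigma>; \<sigma> \<le> 1\<rbrakk> \<Longrightarrow> \<bar>poly p \<sigma>\<bar> \<le> (M::real)"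
proof -
  have "compact (poly p ` {0..1})"
    by (intro compact_continuous_image continuous_intros) simp
  then obtain M where "\<And>y. y \<in> poly p ` {0..1} \<Longrightarrow> norm y \<le> M"
    using compact_imp_bounded bounded_iff by metis
  then have "\<And>\<sigma>. \<lbrakk>0 \<le> \<sigma>; \<sigma> \<le> 1\<rbrakk> \<Longrightarrow> \<bar>poly p \<sigma>\<bar> \<le> max M 0"
    by fastforce
  then show ?thesis
    by (intro that[of "max M 0"]) simp_all
qed

lemma power_dvd_pderiv:
  fixes p :: "real poly"
  assumes "r ^ Suc n dvd p"
  shows "r ^ n dvd pderiv p"
proof -
  from assms obtain q where q: "p = r ^ Suc n * q" ..
  have "pderiv p = r ^ n * (r * pderiv q + smult (1 + real n) (pderiv r * q))"
    unfolding q pderiv_mult pderiv_power_Suc by (simp add: algebra_simps)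
  then show ?thesis by simp
qed

text \<open>
  Repeated integration by parts: the zeros of order \<open>n\<close> at both end points remove all boundary
  terms.
\<close>

lemma poly_integral_higher_pderiv_mult:
  assumes "[:0, 1:] ^ n dvd p" "[:-1, 1:] ^ n dvd p"
  shows "poly_integral ((pderiv ^^ n) p * q) = (-1) ^ n * poly_integral (p * (pderiv ^^ n) q)"
  using assms
proof (induction n arbitrary: p q)
  case (Suc n)
  have "[:0, 1:] dvd p" "[:-1, 1:] dvd p"
    using Suc.prems by (auto simp only: power_Suc intro: dvd_mult_left)
  then have "poly p 0 = 0" "poly p 1 = 0"
    using poly_eq_0_iff_dvd[of p 0] poly_eq_0_iff_dvd[of p 1] by simp_all
  have "poly_integral ((pderiv ^^ Suc n) p * q) = poly_integral ((pderiv ^^ n) (pderiv p) * q)"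
    by (simp add: funpow_swap1)
  also have "\<dots> = (-1) ^ n * poly_integral (pderiv p * (pderiv ^^ n) q)"
    using Suc.prems by (intro Suc.IH power_dvd_pderiv)
  also have "\<dots> = (-1) ^ Suc n * poly_integral (p * (pderiv ^^ Suc n) q)"
    using poly_integral_pderiv_mult[OF \<open>poly p 0 = 0\<close> \<open>poly p 1 = 0\<close>] by simp
  finally show ?case .
qed simp

text \<open>
  The monic Legendre polynomial of the interval \<open>[0, 1]\<close>, by Rodrigues' formula.
\<close>

definition legendre :: "nat \<Rightarrow> real poly"
  where "legendre n = smult (fact n / fact (2 * n)) ((pderiv ^^ n) (([:0, 1:] * [:-1, 1:]) ^ n))"

text \<open>
  The squared norm of \<open>legendre n\<close> in \<open>L\<^sup>2[0, 1]\<close>, as \<open>poly_integral_legendre_power2\<close> shows.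
\<close>

definition legendre_const :: "nat \<Rightarrow> real"
  where "legendre_const n = fact n ^ 4 / (fact (2 * n) * fact (2 * n + 1))"

lemma coeff_higher_pderiv:
  "coeff ((pderiv ^^ n) p) i = fact (n + i) / fact i * coeff p (n + i)" for p :: "real poly"
proof (induction n arbitrary: i)
  case (Suc n)
  have "real (Suc i) * (fact (n + Suc i) / fact (Suc i)) = fact (Suc n + i) / fact i"
    unfolding fact_Suc[of i] by (simp del: fact_Suc of_nat_Suc)
  then show ?case
    by (simp only: funpow.simps o_apply coeff_pderiv Suc.IH add_Suc add_Suc_right mult.assoc[symmetric])
qed simp

lemma higher_pderiv_degree_le:
  fixes p :: "real poly"
  assumes "degree p \<le> n"
  shows "(pderiv ^^ n) p = [:fact n * coeff p n:]"
proof (rule poly_eqI)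
  fix i
  show "coeff ((pderiv ^^ n) p) i = coeff [:fact n * coeff p n:] i"
    using assms by (cases i) (auto simp: coeff_higher_pderiv coeff_eq_0)
qed

text \<open>
  Up to the sign this is the Beta integral \<open>B(n + 1, n + 1)\<close>.
\<close>

lemma poly_integral_power_bump:
  "poly_integral (([:0, 1:] * [:-1, 1:]) ^ n) = (-1) ^ n * (fact n ^ 2 / fact (2 * n + 1))"
proof -
  have "((\<lambda>t::real. t powr (real (Suc n) - 1) * (1 - t) powr (real (Suc n) - 1)) has_integral
      Beta (real (Suc n)) (real (Suc n))) {0..1}"
    by (rule has_integral_Beta_real) simp_all
  also have "Beta (real (Suc n)) (real (Suc n)) = fact n ^ 2 / fact (2 * n + 1)"
    using Gamma_fact[of n, where 'a = real] Gamma_fact[of "2 * n + 1", where 'a = real]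
    by (simp add: Beta_def power2_eq_square add_ac)
  finally have "((\<lambda>t::real. t powr real n * (1 - t) powr real n) has_integral
      fact n ^ 2 / fact (2 * n + 1)) {0..1}"
    by simp
  then have "((\<lambda>t::real. t ^ n * (1 - t) ^ n) has_integral fact n ^ 2 / fact (2 * n + 1)) {0..1}"
    by (rule has_integral_spike_finite[where S = "{0, 1}", rotated 2])
      (auto simp: powr_realpow)
  from has_integral_mult_right[OF this, of "(-1) ^ n"]
  have "(poly (([:0, 1:] * [:-1, 1:]) ^ n :: real poly) has_integral (-1) ^ n * (fact n ^ 2 / fact (2 * n + 1))) {0..1}"
    by (rule has_integral_eq[rotated]) (simp add: algebra_simps flip: power_mult_distrib)
  then show ?thesis
    by (rule poly_integral_eqI)
qed

text \<open>
  Moving the \<open>n\<close> derivatives of Rodrigues' formula to \<open>p\<close> leaves only its coefficient of degree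
  \<open>n\<close>. This contains both the orthogonality to polynomials of lower degree and the norm.
\<close>

lemma poly_integral_legendre_mult:
  assumes "degree p \<le> n"
  shows "poly_integral (legendre n * p) = coeff p n * legendre_const n"
proof -
  let ?Q = "([:0, 1:] * [:-1, 1:]) ^ n :: real poly"
  have "poly_integral ((pderiv ^^ n) ?Q * p) = (-1) ^ n * poly_integral (?Q * (pderiv ^^ n) p)"
    by (rule poly_integral_higher_pderiv_mult)
      (simp_all only: power_mult_distrib dvd_triv_left dvd_triv_right)
  also have "(pderiv ^^ n) p = [:fact n * coeff p n:]"
    using assms by (rule higher_pderiv_degree_le)
  also have "poly_integral (?Q * [:fact n * coeff p n:]) = fact n * coeff p n * poly_integral ?Q"
    by (simp add: poly_integral_smult)
  also have "\<dots> = fact n * coeff p n * ((-1) ^ n * (fact n ^ 2 / fact (2 * n + 1)))"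
    by (simp only: poly_integral_power_bump)
  finally show ?thesis
    by (simp add: legendre_def legendre_const_def poly_integral_smult eval_nat_numeral
        flip: power_mult_distrib)
qed

lemma degree_legendre: "degree (legendre n) \<le> n"
proof (rule degree_le, intro allI impI)
  fix i
  assume "n < i"
  have "degree (([:0, 1:] * [:-1, 1:]) ^ n :: real poly) \<le> 2 * n"
    by (simp add: degree_power_eq)
  then have "coeff (([:0, 1:] * [:-1, 1:]) ^ n :: real poly) (n + i) = 0"
    using \<open>n < i\<close> by (intro coeff_eq_0) simp
  then show "coeff (legendre n) i = 0"
    by (simp add: legendre_def coeff_higher_pderiv)
qed

lemma coeff_legendre: "coeff (legendre n) n = 1"
proof -
  have "degree (([:0, 1:] * [:-1, 1:]) ^ n :: real poly) = n + n"
    by (simp add: degree_power_eq)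
  moreover have "lead_coeff (([:0, 1:] * [:-1, 1:]) ^ n :: real poly) = 1"
    by (simp only: lead_coeff_power lead_coeff_mult) simp
  ultimately have "coeff (([:0, 1:] * [:-1, 1:]) ^ n :: real poly) (n + n) = 1"
    by metis
  then show ?thesis
    unfolding legendre_def coeff_smult coeff_higher_pderiv by (simp add: mult_2)
qed

lemma poly_integral_legendre_power2: "poly_integral (legendre n * legendre n) = legendre_const n"
  by (simp add: poly_integral_legendre_mult degree_legendre coeff_legendre)

text \<open>
  The factor in front of the infimum in \<open>hc_const\<close>.
\<close>

definition decay_factor :: "nat \<Rightarrow> real"
  where "decay_factor m = 1 / (fact (2 * m + 1) * real ((2 * m) choose m))"

lemma decay_factor_pos: "decay_factor m > 0"
  by (simp add: decay_factor_def)

lemma legendre_const_eq: "legendre_const m = (fact m)\<^sup>2 * decay_factor m"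
proof -
  have "real ((2 * m) choose m) = fact (2 * m) / (fact m * fact m)"
    by (subst binomial_fact) (simp_all add: mult_2)
  then show ?thesis
    unfolding legendre_const_def decay_factor_def
    by (simp add: power2_eq_square power4_eq_xxxx mult_ac del: fact_Suc)
qed


section \<open>Dissipation and coercivity\<close>

lemma rinner_herm: "rinner (herm C \<cdot> x) y = (rinner (C \<cdot> x) y + rinner x (C \<cdot> y)) / 2"
  by (simp add: herm_def op_apply_simps rinner_add_left rinner_scaleR_left rinner_adj[of C y x]
      rinner_commute[of "adj C \<cdot> x"] rinner_commute[of x "C \<cdot> y"])

lemma nonneg_herm:
  assumes "accretive C"
  shows "nonneg_op (herm C)"
  unfolding nonneg_op_iff
proof (intro conjI allI)
  show "rinner (herm C \<cdot> x) y = rinner x (herm C \<cdot> y)" for x y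
    unfolding rinner_commute[of x "herm C \<cdot> y"] rinner_herm
    by (simp add: rinner_commute[of _ "C \<cdot> _"])
  show "0 \<le> rinner (herm C \<cdot> x) x" for x
  proof -
    have "0 \<le> rinner (C \<cdot> x) x"
      using assms by (simp add: accretive_def rinner_def)
    then show ?thesis
      by (simp add: rinner_herm rinner_commute[of x "C \<cdot> x"])
  qed
qed

definition dissipation :: "'a::nonzero_complex_hilbert op \<Rightarrow> 'a op"
  where "dissipation C = sqrt_op (herm C)"

lemma rinner_dissipation:
  assumes "accretive C"
  shows "rinner (dissipation C \<cdot> x) (dissipation C \<cdot> y) = rinner (herm C \<cdot> x) y"
proof -
  have "rinner (dissipation C \<cdot> x) (dissipation C \<cdot> y) = rinner (dissipation C \<cdot> dissipation C \<cdot> x) y"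
    using nonneg_sqrt_op(1)[OF nonneg_herm[OF assms]] by (simp add: dissipation_def nonneg_op_iff)
  also have "dissipation C \<cdot> dissipation C \<cdot> x = herm C \<cdot> x"
    using nonneg_sqrt_op(2)[OF nonneg_herm[OF assms]]
    by (simp add: dissipation_def flip: op_apply_simps(2))
  finally show ?thesis .
qed

lemma norm_dissipation:
  assumes "accretive C"
  shows "(norm (dissipation C \<cdot> x))\<^sup>2 = rinner (C \<cdot> x) x"
  using rinner_dissipation[OF assms, of x x]
  by (simp add: rinner_self rinner_herm rinner_commute[of x])

text \<open>
  These vectors are, up to sign, the derivatives at time \<open>0\<close> of \<open>dissipation C\<close> along the orbit of \<open>x\<close>.
\<close>

definition dissipation_jet :: "'a::nonzero_complex_hilbert op \<Rightarrow> nat \<Rightarrow> 'a \<Rightarrow> 'a"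
  where "dissipation_jet C j x = (dissipation C * C ^ j) \<cdot> x"

lemma rinner_adj_power: "rinner ((adj C ^ j) \<cdot> x) y = rinner x ((C ^ j) \<cdot> y)"
proof (induction j arbitrary: x y)
  case (Suc j)
  have "rinner ((adj C ^ Suc j) \<cdot> x) y = rinner (adj C \<cdot> (adj C ^ j) \<cdot> x) y"
    by (simp add: op_apply_simps)
  also have "\<dots> = rinner ((adj C ^ j) \<cdot> x) (C \<cdot> y)"
    using rinner_adj[of C y] by (metis rinner_commute)
  also have "\<dots> = rinner x ((C ^ j * C) \<cdot> y)"
    by (simp add: Suc op_apply_simps)
  finally show ?case
    by (simp add: power_commutes)
qed (simp add: op_apply_simps)

text \<open>
  The sum in the definition of coercivity is self-adjoint, and its quadratic form is the sum of the
  squared jets. By homogeneity it can be tested on unit vectors.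
\<close>

lemma hc_coercive_iff:
  assumes "accretive C"
  shows "hc_coercive C m \<longleftrightarrow>
    (\<exists>\<kappa>>0. \<forall>x. norm x = 1 \<longrightarrow> \<kappa> \<le> (\<Sum>j\<le>m. (norm (dissipation_jet C j x))\<^sup>2))"
proof -
  let ?S = "\<Sum>j=0..m. adj C ^ j * herm C * C ^ j"
  have form: "rinner (?S \<cdot> x) y = (\<Sum>j\<le>m. rinner (dissipation_jet C j x) (dissipation_jet C j y))" for x y
    by (simp add: op_apply.sum_left rinner.sum_left op_apply_simps rinner_adj_power dissipation_jet_def
        atMost_atLeast0 rinner_dissipation[OF assms])
  have "op_le (\<kappa> *\<^sub>R 1) ?S \<longleftrightarrow> (\<forall>x. norm x = 1 \<longrightarrow> \<kappa> \<le> (\<Sum>j\<le>m. (norm (dissipation_jet C j x))\<^sup>2))" for \<kappa>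
  proof -
    have diff: "rinner ((?S - \<kappa> *\<^sub>R 1) \<cdot> x) y = rinner (?S \<cdot> x) y - \<kappa> * rinner x y" for x y
      by (simp add: op_apply_simps rinner.diff_left rinner.scaleR_left)
    have "rinner ((?S - \<kappa> *\<^sub>R 1) \<cdot> x) y = rinner x ((?S - \<kappa> *\<^sub>R 1) \<cdot> y)" for x y
      unfolding rinner_commute[of x "(?S - \<kappa> *\<^sub>R 1) \<cdot> y"] diff form
      by (simp add: rinner_commute)
    then have "op_le (\<kappa> *\<^sub>R 1) ?S \<longleftrightarrow> (\<forall>x. \<kappa> * (norm x)\<^sup>2 \<le> (\<Sum>j\<le>m. (norm (dissipation_jet C j x))\<^sup>2))"
      unfolding op_le_def nonneg_op_iff diff by (simp add: form rinner_self)
    also have "\<dots> \<longleftrightarrow> (\<forall>x. norm x = 1 \<longrightarrow> \<kappa> \<le> (\<Sum>j\<le>m. (norm (dissipation_jet C j x))\<^sup>2))"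
    proof (intro iffI allI impI)
      fix x :: 'a
      assume unit: "\<forall>x. norm x = 1 \<longrightarrow> \<kappa> \<le> (\<Sum>j\<le>m. (norm (dissipation_jet C j x))\<^sup>2)"
      show "\<kappa> * (norm x)\<^sup>2 \<le> (\<Sum>j\<le>m. (norm (dissipation_jet C j x))\<^sup>2)"
      proof (cases "x = 0")
        case True
        then show ?thesis by (simp add: sum_nonneg)
      next
        case False
        then have "\<kappa> \<le> (\<Sum>j\<le>m. (norm (dissipation_jet C j (inverse (norm x) *\<^sub>R x)))\<^sup>2)"
          using unit by simp
        also have "\<dots> = (\<Sum>j\<le>m. (norm (dissipation_jet C j x))\<^sup>2) / (norm x)\<^sup>2"
          by (simp add: dissipation_jet_def op_apply.scaleR_right power_mult_distrib power_divide
              divide_inverse sum_distrib_left power_inverse mult.commute)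
        finally show ?thesis
          using False by (simp add: field_simps)
      qed
    next
      fix x :: 'a
      assume "\<forall>x. \<kappa> * (norm x)\<^sup>2 \<le> (\<Sum>j\<le>m. (norm (dissipation_jet C j x))\<^sup>2)" "norm x = 1"
      then show "\<kappa> \<le> (\<Sum>j\<le>m. (norm (dissipation_jet C j x))\<^sup>2)"
        by (metis mult.right_neutral one_power2)
    qed
    finally show ?thesis .
  qed
  then show ?thesis
    by (simp add: hc_coercive_def)
qed


section \<open>Energy loss along orbits\<close>

definition evolution :: "'a::nonzero_complex_hilbert op \<Rightarrow> real \<Rightarrow> 'a op"
  where "evolution C t = exp (- (t *\<^sub>R C))"

definition energy_loss :: "'a::nonzero_complex_hilbert op \<Rightarrow> real \<Rightarrow> 'a \<Rightarrow> real"
  where "energy_loss C t x = ((norm x)\<^sup>2 - (norm (evolution C t \<cdot> x))\<^sup>2) / 2"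

lemma evolution_0: "evolution C 0 = 1"
  by (simp add: evolution_def)

lemma evolution_has_vector_derivative:
  "((\<lambda>t. evolution C t \<cdot> x) has_vector_derivative - (C \<cdot> evolution C t \<cdot> x)) (at t within S)"
proof -
  have "((\<lambda>t. exp (t *\<^sub>R (- C))) has_vector_derivative - C * exp (t *\<^sub>R (- C))) (at t within S)"
    unfolding exp_times_scaleR_commute[symmetric] by (rule exp_scaleR_has_vector_derivative_right)
  from bounded_linear.has_vector_derivative[OF op_apply.bounded_linear_left this, of x]
  show ?thesis
    by (simp add: evolution_def op_apply_simps op_apply.minus_left )
qed

lemma energy_loss_has_derivative:
  assumes "accretive C"
  shows "((\<lambda>t. energy_loss C t x) has_real_derivative (norm (dissipation C \<cdot> evolution C t \<cdot> x))\<^sup>2)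
    (at t within S)"
proof -
  let ?u = "\<lambda>t. evolution C t \<cdot> x"
  have "((\<lambda>t. rinner (?u t) (?u t)) has_vector_derivative
      rinner (?u t) (- (C \<cdot> ?u t)) + rinner (- (C \<cdot> ?u t)) (?u t)) (at t within S)"
    by (intro bounded_bilinear.has_vector_derivative[OF bounded_bilinear_rinner]
        evolution_has_vector_derivative)
  then have "((\<lambda>t. (norm (?u t))\<^sup>2) has_real_derivative
      - 2 * (norm (dissipation C \<cdot> ?u t))\<^sup>2) (at t within S)"
    by (simp add: rinner_self has_real_derivative_iff_has_vector_derivative rinner.minus_left
        rinner.minus_right rinner_commute[of _ "C \<cdot> ?u t"] norm_dissipation[OF assms])
  from DERIV_cdivide[OF DERIV_diff[OF DERIV_const[of "(norm x)\<^sup>2"] this], of 2]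
  show ?thesis
    by (simp add: energy_loss_def)
qed

text \<open>
  The time interval \<open>[0, t]\<close> is rescaled to \<open>[0, 1]\<close>, where the Legendre polynomials live.
\<close>

lemma energy_loss_has_integral:
  assumes "accretive C"
  shows "((\<lambda>\<sigma>. t * (norm (dissipation C \<cdot> evolution C (t * \<sigma>) \<cdot> x))\<^sup>2) has_integral energy_loss C t x) {0..1}"
proof -
  have "((\<lambda>\<sigma>. energy_loss C (t * \<sigma>) x) has_real_derivative
      t * (norm (dissipation C \<cdot> evolution C (t * \<sigma>) \<cdot> x))\<^sup>2) (at \<sigma> within {0..1})" for \<sigma>
    unfolding mult.commute[of t "(norm _)\<^sup>2"]
    by (rule DERIV_chain'[OF DERIV_cmult_Id energy_loss_has_derivative[OF assms]])
  then have "((\<lambda>\<sigma>. t * (norm (dissipation C \<cdot> evolution C (t * \<sigma>) \<cdot> x))\<^sup>2) has_integral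
      (energy_loss C (t * 1) x - energy_loss C (t * 0) x)) {0..1}"
    by (intro fundamental_theorem_of_calculus)
      (simp_all add: has_real_derivative_iff_has_vector_derivative)
  then show ?thesis
    by (simp add: energy_loss_def[of C 0] evolution_0 op_apply_simps)
qed

lemma energy_loss_ge:
  assumes "accretive C" "t \<ge> 0"
    and "\<And>\<sigma>. \<lbrakk>0 \<le> \<sigma>; \<sigma> \<le> 1\<rbrakk> \<Longrightarrow> poly w \<sigma> \<le> (norm (dissipation C \<cdot> evolution C (t * \<sigma>) \<cdot> x))\<^sup>2"
  shows "t * poly_integral w \<le> energy_loss C t x"
  by (rule has_integral_le[OF has_integral_mult_right[OF has_integral_poly]
        energy_loss_has_integral[OF assms(1)]]) (use assms in \<open>auto intro: mult_left_mono\<close>)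

lemma energy_loss_le:
  assumes "accretive C" "t \<ge> 0"
    and "\<And>\<sigma>. \<lbrakk>0 \<le> \<sigma>; \<sigma> \<le> 1\<rbrakk> \<Longrightarrow> (norm (dissipation C \<cdot> evolution C (t * \<sigma>) \<cdot> x))\<^sup>2 \<le> poly w \<sigma>"
  shows "energy_loss C t x \<le> t * poly_integral w"
  by (rule has_integral_le[OF energy_loss_has_integral[OF assms(1)]
        has_integral_mult_right[OF has_integral_poly]]) (use assms in \<open>auto intro: mult_left_mono\<close>)

lemma norm_evolution_le_1:
  assumes "accretive C" "t \<ge> 0"
  shows "norm (evolution C t) \<le> 1"
proof (rule op_norm_le)
  fix x :: 'a
  assume "norm x = 1"
  have "t * poly_integral 0 \<le> energy_loss C t x"
    by (rule energy_loss_ge) (use assms in simp_all)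
  then have "(norm (evolution C t \<cdot> x))\<^sup>2 \<le> 1\<^sup>2"
    using \<open>norm x = 1\<close> poly_integral_smult[of 0 0] by (simp add: energy_loss_def)
  then show "norm (evolution C t \<cdot> x) \<le> 1"
    by (rule power2_le_imp_le) simp
qed simp

text \<open>
  The tail of the exponential series is compared termwise, with \<open>1 / (n + k)! \<le> 1 / n!\<close>.
\<close>

lemma norm_exp_minus_taylor_le:
  fixes X :: "'b::{real_normed_algebra_1, banach}"
  shows "norm (exp X - (\<Sum>j<k. X ^ j /\<^sub>R fact j)) \<le> norm X ^ k * exp (norm X)"
proof -
  have "(\<lambda>n. X ^ (n + k) /\<^sub>R fact (n + k)) sums (exp X - (\<Sum>j<k. X ^ j /\<^sub>R fact j))"
    by (subst sums_iff_shift) (simp add: exp_converges)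
  moreover have "(\<lambda>n. norm X ^ k * (norm X ^ n /\<^sub>R fact n)) sums (norm X ^ k * exp (norm X))"
    by (intro sums_mult exp_converges)
  moreover have "norm (X ^ (n + k) /\<^sub>R fact (n + k)) \<le> norm X ^ k * (norm X ^ n /\<^sub>R fact n)" for n
  proof -
    have "norm (X ^ (n + k)) \<le> norm X ^ (n + k)"
      by (rule norm_power_ineq)
    moreover have "inverse (fact (n + k)) \<le> (inverse (fact n) :: real)"
      by (intro le_imp_inverse_le fact_mono) simp_all
    ultimately have "inverse (fact (n + k)) * norm (X ^ (n + k)) \<le> inverse (fact n) * norm X ^ (n + k)"
      by (intro mult_mono) simp_all
    then show ?thesis
      by (simp add: power_add mult_ac)
  qed
  ultimately show ?thesis
    by (metis (no_types, lifting) norm_sums_le)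
qed

lemma dissipation_evolution_taylor:
  obtains K where "K \<ge> 0" and
    "\<And>s y. \<lbrakk>0 \<le> s; s \<le> 1\<rbrakk> \<Longrightarrow>
      norm (dissipation C \<cdot> evolution C s \<cdot> y - (\<Sum>j\<le>k. ((- s) ^ j / fact j) *\<^sub>R dissipation_jet C j y))
        \<le> K * s ^ Suc k * norm y"
proof
  let ?K = "norm (dissipation C) * (norm C ^ Suc k * exp (norm C))"
  show "0 \<le> ?K" by simp
  fix s :: real and y
  assume s: "0 \<le> s" "s \<le> 1"
  define E where "E = exp ((- s) *\<^sub>R C) - (\<Sum>j<Suc k. ((- s) *\<^sub>R C) ^ j /\<^sub>R fact j)"
  have "norm E \<le> norm ((- s) *\<^sub>R C) ^ Suc k * exp (norm ((- s) *\<^sub>R C))"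
    unfolding E_def by (rule norm_exp_minus_taylor_le)
  also have "\<dots> \<le> norm ((- s) *\<^sub>R C) ^ Suc k * exp (norm C)"
    using s by (intro mult_left_mono) (auto simp: mult_left_le_one_le)
  also have "\<dots> = s ^ Suc k * (norm C ^ Suc k * exp (norm C))"
    using s by (simp add: power_mult_distrib)
  finally have E: "norm E \<le> s ^ Suc k * (norm C ^ Suc k * exp (norm C))" .
  have "(dissipation C * E) \<cdot> y =
      dissipation C \<cdot> evolution C s \<cdot> y - (\<Sum>j\<le>k. ((- s) ^ j / fact j) *\<^sub>R dissipation_jet C j y)"
    by (simp add: E_def evolution_def dissipation_jet_def op_apply_simps op_apply.sum_left
        op_apply.diff_right op_apply.sum_right op_apply.scaleR_left op_apply.scaleR_right
        lessThan_Suc_atMost scaleR_power divide_inverse mult.commute del: sum.lessThan_Suc scaleR_minus_left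
        flip: scaleR_minus_left)
  moreover have "norm ((dissipation C * E) \<cdot> y) \<le> norm (dissipation C) * norm E * norm y"
    using norm_op_apply_le[of "dissipation C * E" y] norm_mult_ineq[of "dissipation C" E]
    by (meson mult_right_mono norm_ge_zero order_trans)
  moreover have "norm (dissipation C) * norm E * norm y
      \<le> norm (dissipation C) * (s ^ Suc k * (norm C ^ Suc k * exp (norm C))) * norm y"
    by (intro mult_right_mono mult_left_mono E) simp_all
  ultimately show "norm (dissipation C \<cdot> evolution C s \<cdot> y - (\<Sum>j\<le>k. ((- s) ^ j / fact j) *\<^sub>R dissipation_jet C j y))
      \<le> ?K * s ^ Suc k * norm y"
    by (simp add: mult_ac)
qed


section \<open>Two-sided estimates of the energy loss\<close>

lemma norm_dissipation_jet_le: "norm (dissipation_jet C j x) \<le> norm (dissipation C * C ^ j) * norm x"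
  unfolding dissipation_jet_def by (rule norm_op_apply_le)

text \<open>
  Testing the dissipation \<open>u\<close> against the unit vector \<open>e\<close> in the direction of the \<open>k\<close>-th jet reduces to a
  scalar function, which is a polynomial \<open>p\<close> of degree \<open>k\<close> up to an error of order \<open>t\<^bsup>k+1\<^esup>\<close>. The
  integral of its square is minimal for the multiple of the Legendre polynomial with the same
  leading coefficient. As the error is of higher order for every \<open>k\<close>, the estimate holds for the jet of
  each order, irrespective of the size of the others.
\<close>

lemma energy_loss_lower_bound:
  assumes C: "accretive C"
  obtains K where "\<And>t x. \<lbrakk>0 \<le> t; t \<le> 1; norm x = 1\<rbrakk> \<Longrightarrow>
    t ^ (2 * k + 1) * (decay_factor k * (norm (dissipation_jet C k x))\<^sup>2 - K * t) \<le> energy_loss C t x"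
proof -
  obtain K0 where K0: "K0 \<ge> 0" "\<And>s y. \<lbrakk>0 \<le> s; s \<le> 1\<rbrakk> \<Longrightarrow>
      norm (dissipation C \<cdot> evolution C s \<cdot> y - (\<Sum>j\<le>k. ((- s) ^ j / fact j) *\<^sub>R dissipation_jet C j y))
        \<le> K0 * s ^ Suc k * norm y"
    using dissipation_evolution_taylor by blast
  obtain M where M: "M \<ge> 0" "\<And>\<sigma>. \<lbrakk>0 \<le> \<sigma>; \<sigma> \<le> 1\<rbrakk> \<Longrightarrow> \<bar>poly (legendre k) \<sigma>\<bar> \<le> M"
    using abs_poly_bounded_unit_interval by blast
  define V where "V = norm (dissipation C * C ^ k)"
  define K where "K = 2 * V * M * K0"
  have "t ^ (2 * k + 1) * (decay_factor k * (norm (dissipation_jet C k x))\<^sup>2 - K * t) \<le> energy_loss C t x"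
    if t: "0 \<le> t" "t \<le> 1" and x: "norm x = 1" for t x
  proof -
    define N where "N = norm (dissipation_jet C k x)"
    have "0 \<le> N" "N \<le> V"
      using norm_dissipation_jet_le[of C k x] by (simp_all add: N_def V_def x)
    \<comment> \<open>If the jet vanishes, then so does \<open>e\<close>, and the argument goes through unchanged.\<close>
    define e where "e = sgn (dissipation_jet C k x)"
    have "norm e \<le> 1"
      by (simp add: e_def norm_sgn)
    have rinner_e: "rinner (dissipation_jet C k x) e = N"
      by (cases "dissipation_jet C k x = 0")
        (simp_all add: e_def N_def rinner.zero_left sgn_div_norm rinner.scaleR_right rinner_self power2_eq_square)
    define p where "p = (\<Sum>j\<le>k. monom ((- t) ^ j / fact j * rinner (dissipation_jet C j x) e) j)"
    have "degree p \<le> k"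
      unfolding p_def by (intro degree_sum_le) (auto intro: order_trans[OF degree_monom_le])
    define l where "l = (- t) ^ k / fact k * N"
    have coeff_p: "coeff p k = l"
      by (simp add: p_def coeff_sum l_def rinner_e)
    have abs_l: "\<bar>l\<bar> \<le> t ^ k * V"
    proof -
      have "\<bar>l\<bar> = t ^ k * N / fact k"
        using t \<open>0 \<le> N\<close> by (simp add: l_def abs_mult power_abs)
      also have "\<dots> \<le> t ^ k * N / 1"
        using t \<open>0 \<le> N\<close> by (intro divide_left_mono) simp_all
      also have "\<dots> \<le> t ^ k * V"
        using t \<open>N \<le> V\<close> by (simp add: mult_left_mono)
      finally show ?thesis .
    qed
    define r where "r = 2 * \<bar>l\<bar> * M * (K0 * t ^ Suc k)"
    \<comment> \<open>A polynomial minorant of the dissipation: it comes from \<open>h\<^sup>2 \<ge> 2 l q h - l\<^sup>2 q\<^sup>2\<close>, where \<open>h = \<langle>u, e\<rangle>\<close> and \<open>q\<close>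
      is the Legendre polynomial, by replacing \<open>h\<close> by \<open>p\<close> at the cost of \<open>r\<close>.\<close>
    define w where "w = smult (2 * l) (legendre k * p) + ([:- r:] + smult (- (l\<^sup>2)) (legendre k * legendre k))"
    have "t * poly_integral w \<le> energy_loss C t x"
    proof (rule energy_loss_ge[OF C t(1)])
      fix \<sigma> :: real
      assume \<sigma>: "0 \<le> \<sigma>" "\<sigma> \<le> 1"
      define u where "u = dissipation C \<cdot> evolution C (t * \<sigma>) \<cdot> x"
      define q where "q = poly (legendre k) \<sigma>"
      have ts: "0 \<le> t * \<sigma>" "t * \<sigma> \<le> 1" "t * \<sigma> \<le> t"
        using t \<sigma> by (auto intro: mult_le_one mult_left_le)
      have "(- (t * \<sigma>)) ^ j = (- t) ^ j * \<sigma> ^ j" for j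
        by (simp flip: power_mult_distrib)
      then have "poly p \<sigma> = rinner (\<Sum>j\<le>k. ((- (t * \<sigma>)) ^ j / fact j) *\<^sub>R dissipation_jet C j x) e"
        by (simp add: p_def poly_sum poly_monom rinner.sum_left rinner.scaleR_left mult_ac)
      then have "\<bar>rinner u e - poly p \<sigma>\<bar>
          \<le> norm (u - (\<Sum>j\<le>k. ((- (t * \<sigma>)) ^ j / fact j) *\<^sub>R dissipation_jet C j x)) * norm e"
        using abs_rinner_le_norm by (simp flip: rinner.diff_left)
      also have "\<dots> \<le> K0 * (t * \<sigma>) ^ Suc k * norm x * 1"
        unfolding u_def using K0(1) K0(2)[OF ts(1,2)] ts \<open>norm e \<le> 1\<close> by (intro mult_mono) simp_all
      also have "\<dots> \<le> K0 * t ^ Suc k"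
        using K0(1) ts by (simp add: x mult_left_mono power_mono del: power_Suc)
      finally have "\<bar>rinner u e - poly p \<sigma>\<bar> \<le> K0 * t ^ Suc k" .
      then have "\<bar>2 * l * q\<bar> * \<bar>rinner u e - poly p \<sigma>\<bar> \<le> 2 * \<bar>l\<bar> * M * (K0 * t ^ Suc k)"
        using M(1) M(2)[OF \<sigma>] by (intro mult_mono) (auto simp: abs_mult q_def intro!: mult_left_mono)
      then have "- r \<le> 2 * l * q * (rinner u e - poly p \<sigma>)"
        unfolding r_def using abs_ge_minus_self[of "2 * l * q * (rinner u e - poly p \<sigma>)"]
        by (simp only: abs_mult)
      moreover have "0 \<le> (rinner u e - l * q)\<^sup>2"
        by simp
      ultimately have "2 * l * (q * poly p \<sigma>) - r - l\<^sup>2 * (q * q) \<le> (rinner u e)\<^sup>2"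
        by (simp add: power2_eq_square algebra_simps)
      also have "\<dots> \<le> (norm u)\<^sup>2"
        using abs_rinner_le_norm[of u e] mult_left_mono[OF \<open>norm e \<le> 1\<close> norm_ge_zero[of u]]
        by (intro abs_le_square_iff[THEN iffD1]) simp
      finally show "poly w \<sigma> \<le> (norm (dissipation C \<cdot> evolution C (t * \<sigma>) \<cdot> x))\<^sup>2"
        by (simp add: w_def q_def u_def)
    qed
    also have "poly_integral w = l\<^sup>2 * legendre_const k - r"
      by (simp add: w_def poly_integral_add poly_integral_smult poly_integral_legendre_power2
          poly_integral_const
          poly_integral_legendre_mult \<open>degree p \<le> k\<close> coeff_p power2_eq_square del: smult_minus_left)
    also have "l\<^sup>2 * legendre_const k = t ^ (2 * k) * (decay_factor k * N\<^sup>2)"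
    proof -
      have "((- t) ^ k)\<^sup>2 = t ^ (2 * k)"
        by (simp only: power_mult[symmetric] mult.commute[of k]) (simp add: power_mult)
      then show ?thesis
        by (simp add: l_def legendre_const_eq power_mult_distrib power_divide)
    qed
    finally have "t * (t ^ (2 * k) * (decay_factor k * N\<^sup>2) - r) \<le> energy_loss C t x" .
    moreover have "r \<le> t ^ (2 * k) * (K * t)"
    proof -
      have "r \<le> 2 * (t ^ k * V) * M * (K0 * t ^ Suc k)"
        unfolding r_def using abs_l M(1) K0(1) t by (intro mult_right_mono mult_left_mono) simp_all
      also have "\<dots> = t ^ (2 * k) * (K * t)"
        unfolding K_def mult_2[of k] power_add power_Suc by (simp only: mult_ac)
      finally show ?thesis .
    qed
    then have "t * (t ^ (2 * k) * (decay_factor k * N\<^sup>2) - t ^ (2 * k) * (K * t))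
        \<le> t * (t ^ (2 * k) * (decay_factor k * N\<^sup>2) - r)"
      using t by (intro mult_left_mono) simp_all
    ultimately show ?thesis
      by (simp add: N_def algebra_simps)
  qed
  then show ?thesis
    using that by blast
qed


text \<open>
  Chosen such that the terms of order \<open>m\<close> in the product of \<open>exp (-sC)\<close> and
  \<open>\<Sum>\<^sub>k corrector_coeff m k * t\<^sup>k C\<^sup>k\<close> add up to \<open>(-t)\<^sup>m / m!\<close> times the Legendre polynomial at \<open>s / t\<close>.
\<close>

definition corrector_coeff :: "nat \<Rightarrow> nat \<Rightarrow> real"
  where "corrector_coeff m k = (-1) ^ k * fact (m - k) / fact m * coeff (legendre m) (m - k)"

text \<open>
  For the corrected vector \<open>y\<close>, the Taylor polynomial of the dissipation is a double sum of
  multiples of the jets of \<open>x\<close>. Terms of total order below \<open>m\<close> contain a jet that is small by assumption,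
  those above \<open>m\<close> contain at least \<open>t\<^bsup>m+1\<^esup>\<close>, and those of order \<open>m\<close> form the Legendre polynomial.
\<close>

lemma energy_loss_corrected:
  assumes C: "accretive C"
  obtains K where "K \<ge> 0" and "\<And>t x. \<lbrakk>0 \<le> t; t \<le> 1; norm x = 1; \<And>j. j < m \<Longrightarrow> norm (dissipation_jet C j x) \<le> t ^ Suc m\<rbrakk> \<Longrightarrow>
    \<exists>y. 1 - K * t \<le> (norm y)\<^sup>2 \<and>
      energy_loss C t y \<le> t ^ (2 * m + 1) * (decay_factor m * (norm (dissipation_jet C m x))\<^sup>2 + K * t)"
proof -
  obtain K0 where K0: "K0 \<ge> 0" "\<And>s y. \<lbrakk>0 \<le> s; s \<le> 1\<rbrakk> \<Longrightarrow>
      norm (dissipation C \<cdot> evolution C s \<cdot> y - (\<Sum>j\<le>m. ((- s) ^ j / fact j) *\<^sub>R dissipation_jet C j y))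
        \<le> K0 * s ^ Suc m * norm y"
    using dissipation_evolution_taylor by blast
  obtain M where M: "M \<ge> 0" "\<And>\<sigma>. \<lbrakk>0 \<le> \<sigma>; \<sigma> \<le> 1\<rbrakk> \<Longrightarrow> \<bar>poly (legendre m) \<sigma>\<bar> \<le> M"
    using abs_poly_bounded_unit_interval by blast
  define a where "a = corrector_coeff m"
  have a0: "a 0 = 1"
    by (simp add: a_def corrector_coeff_def coeff_legendre)
  define V where "V = norm (dissipation C * C ^ m)"
  define W where "W = (\<Sum>i\<le>2 * m. norm (dissipation C * C ^ i))"
  have W: "W \<ge> 0"
    by (simp add: W_def sum_nonneg)
  define Y where "Y = (\<Sum>k\<le>m. \<bar>a k\<bar> * norm (C ^ k))"
  have Y: "Y \<ge> 0"
    by (simp add: Y_def sum_nonneg)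
  define K1 where "K1 = (\<Sum>j\<le>m. \<Sum>k\<le>m. \<bar>a k\<bar> * (1 + W))"
  define K2 where "K2 = K1 + K0 * Y"
  have "K2 \<ge> 0"
    using W K0(1) Y by (auto simp: K2_def K1_def intro!: add_nonneg_nonneg sum_nonneg mult_nonneg_nonneg)
  define K3 where "K3 = 2 * (M * V) * K2 + K2\<^sup>2"
  have "V \<ge> 0" by (simp add: V_def)
  then have "K3 \<ge> 0"
    using M(1) \<open>K2 \<ge> 0\<close> by (simp add: K3_def)
  define K where "K = max K3 (2 * Y)"
  have "K \<ge> 0" "K3 \<le> K" "2 * Y \<le> K"
    using \<open>K3 \<ge> 0\<close> by (simp_all add: K_def)
  have "\<exists>y. 1 - K * t \<le> (norm y)\<^sup>2 \<and>
      energy_loss C t y \<le> t ^ (2 * m + 1) * (decay_factor m * (norm (dissipation_jet C m x))\<^sup>2 + K * t)"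
    if t: "0 \<le> t" "t \<le> 1" and x: "norm x = 1"
      and small: "\<And>j. j < m \<Longrightarrow> norm (dissipation_jet C j x) \<le> t ^ Suc m" for t x
  proof -
    define v where "v j = dissipation_jet C j x" for j
    have v_le: "norm (v j) \<le> norm (dissipation C * C ^ j)" for j
      using norm_dissipation_jet_le[of C j x] by (simp add: v_def x)
    define y where "y = (\<Sum>k\<le>m. (a k * t ^ k) *\<^sub>R ((C ^ k) \<cdot> x))"
    have term_le: "norm ((a k * t ^ k) *\<^sub>R ((C ^ k) \<cdot> x)) \<le> t ^ k * (\<bar>a k\<bar> * norm (C ^ k))" for k
      using mult_left_mono[OF norm_op_apply_le[of "C ^ k" x], of "t ^ k * \<bar>a k\<bar>"] t
      by (simp add: x abs_mult mult_ac)
    have "norm y \<le> Y"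
      unfolding y_def Y_def
    proof (rule sum_norm_le)
      fix k
      have "t ^ k * (\<bar>a k\<bar> * norm (C ^ k)) \<le> 1 * (\<bar>a k\<bar> * norm (C ^ k))"
        using t by (intro mult_right_mono power_le_one) simp_all
      with term_le[of k] show "norm ((a k * t ^ k) *\<^sub>R ((C ^ k) \<cdot> x)) \<le> \<bar>a k\<bar> * norm (C ^ k)"
        by simp
    qed
    have norm_y: "1 - K * t \<le> (norm y)\<^sup>2"
    proof -
      have "norm (y - x) \<le> t * Y"
      proof -
        have "y - x = (\<Sum>k\<in>{..m} - {0}. (a k * t ^ k) *\<^sub>R ((C ^ k) \<cdot> x))"
          unfolding y_def by (subst sum.remove[of _ 0]) (simp_all add: a0 op_apply_simps)
        also have "norm \<dots> \<le> (\<Sum>k\<in>{..m} - {0}. t * (\<bar>a k\<bar> * norm (C ^ k)))"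
        proof (rule sum_norm_le)
          fix k
          assume "k \<in> {..m} - {0}"
          then have "t ^ k \<le> t ^ 1"
            using t by (intro power_decreasing) auto
          then have "t ^ k * (\<bar>a k\<bar> * norm (C ^ k)) \<le> t * (\<bar>a k\<bar> * norm (C ^ k))"
            by (intro mult_right_mono) simp_all
          with term_le[of k] show "norm ((a k * t ^ k) *\<^sub>R ((C ^ k) \<cdot> x)) \<le> t * (\<bar>a k\<bar> * norm (C ^ k))"
            by simp
        qed
        also have "\<dots> \<le> (\<Sum>k\<le>m. t * (\<bar>a k\<bar> * norm (C ^ k)))"
          using t by (intro sum_mono2) auto
        finally show ?thesis
          by (simp add: Y_def sum_distrib_left)
      qed
      moreover have "(norm x)\<^sup>2 + 2 * rinner x (y - x) \<le> (norm y)\<^sup>2"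
        using norm_add_power2[of x "y - x"] by simp
      moreover have "- norm (y - x) \<le> rinner x (y - x)"
        using abs_rinner_le_norm[of x "y - x"] by (simp add: x abs_le_iff)
      moreover have "2 * (t * Y) \<le> K * t"
        using mult_right_mono[OF \<open>2 * Y \<le> K\<close> t(1)] by (simp add: mult_ac)
      ultimately show ?thesis
        by (simp add: x)
    qed
    define w where "w = smult (t ^ (2 * m) / (fact m)\<^sup>2 * (norm (v m))\<^sup>2) (legendre m * legendre m) + [:K3 * t ^ (2 * m + 1):]"
    have "energy_loss C t y \<le> t * poly_integral w"
    proof (rule energy_loss_le[OF C t(1)])
      fix \<sigma> :: real
      assume \<sigma>: "0 \<le> \<sigma>" "\<sigma> \<le> 1"
      define s where "s = t * \<sigma>"
      have s: "0 \<le> s" "s \<le> 1" "s \<le> t"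
        using t \<sigma> by (auto simp: s_def intro: mult_le_one mult_left_le)
      define u where "u = dissipation C \<cdot> evolution C s \<cdot> y"
      define q where "q = (- t) ^ m / fact m * poly (legendre m) \<sigma>"
      \<comment> \<open>The coefficient of the jet of order \<open>j + k\<close> in the Taylor polynomial.\<close>
      define d where "d j k = (- s) ^ j / fact j * (a k * t ^ k)" for j k
      have jet_y: "dissipation_jet C j y = (\<Sum>k\<le>m. (a k * t ^ k) *\<^sub>R v (j + k))" for j
        by (simp add: y_def v_def dissipation_jet_def op_apply.sum_right op_apply.scaleR_right
            op_apply_simps power_add)
      have abs_d: "\<bar>d j k\<bar> \<le> \<bar>a k\<bar> * t ^ (j + k)" for j k
      proof -
        have "\<bar>d j k\<bar> = (\<bar>a k\<bar> * t ^ k) * (s ^ j / fact j)"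
          using s t by (simp add: d_def abs_mult power_abs)
        also have "\<dots> \<le> (\<bar>a k\<bar> * t ^ k) * (t ^ j / 1)"
          using s t by (intro mult_left_mono frac_le power_mono) simp_all
        finally show ?thesis
          by (simp add: power_add mult_ac)
      qed
      have off_diag: "norm (d j k *\<^sub>R v (j + k) - (if k = m - j then d j k *\<^sub>R v m else 0)) \<le> \<bar>a k\<bar> * (1 + W) * t ^ Suc m"
        if "j \<le> m" "k \<le> m" for j k
      proof -
        consider "j + k < m" | "j + k = m" | "j + k > m" by linarith
        then show ?thesis
        proof cases
          case 1
          then have "t ^ (j + k) * norm (v (j + k)) \<le> 1 * t ^ Suc m"
            using small[of "j + k"] t unfolding v_def by (intro mult_mono power_le_one) simp_all
          also have "\<dots> \<le> (1 + W) * t ^ Suc m"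
            using W t by (intro mult_right_mono) simp_all
          finally have "\<bar>a k\<bar> * (t ^ (j + k) * norm (v (j + k))) \<le> \<bar>a k\<bar> * ((1 + W) * t ^ Suc m)"
            by (rule mult_left_mono) simp
          moreover have "\<bar>d j k\<bar> * norm (v (j + k)) \<le> \<bar>a k\<bar> * t ^ (j + k) * norm (v (j + k))"
            by (rule mult_right_mono[OF abs_d]) simp
          moreover have "k \<noteq> m - j"
            using 1 by arith
          ultimately show ?thesis
            by (simp add: mult.assoc)
        next
          case 2
          then have "k = m - j" by simp
          then show ?thesis
            using 2 W t by simp
        next
          case 3
          have "norm (v (j + k)) \<le> W"
            using v_le[of "j + k"] member_le_sum[of "j + k" "{..2 * m}" "\<lambda>i. norm (dissipation C * C ^ i)"] that
            by (simp add: W_def)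
          moreover have "t ^ (j + k) \<le> t ^ Suc m"
            using 3 t by (intro power_decreasing) simp_all
          ultimately have "t ^ (j + k) * norm (v (j + k)) \<le> t ^ Suc m * (1 + W)"
            using t by (intro mult_mono) (simp_all del: power_Suc)
          then have "\<bar>a k\<bar> * (t ^ (j + k) * norm (v (j + k))) \<le> \<bar>a k\<bar> * (t ^ Suc m * (1 + W))"
            by (rule mult_left_mono) simp
          moreover have "\<bar>d j k\<bar> * norm (v (j + k)) \<le> \<bar>a k\<bar> * t ^ (j + k) * norm (v (j + k))"
            by (rule mult_right_mono[OF abs_d]) simp
          moreover have "k \<noteq> m - j"
            using 3 that by arith
          ultimately show ?thesis
            by (simp add: mult_ac)
        qed
      qed
      have diag: "(\<Sum>j\<le>m. d j (m - j)) = q"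
      proof -
        have "d j (m - j) = (- t) ^ m / fact m * (coeff (legendre m) j * \<sigma> ^ j)" if "j \<le> m" for j
        proof -
          have "(- t) ^ m = (- t) ^ j * (- t) ^ (m - j)"
            using that by (simp flip: power_add)
          moreover have "(- s) ^ j = (- t) ^ j * \<sigma> ^ j"
            by (simp add: s_def flip: power_mult_distrib)
          moreover have "(- t) ^ (m - j) = (-1) ^ (m - j) * t ^ (m - j)"
            by (simp flip: power_mult_distrib)
          ultimately show ?thesis
            using that by (simp add: d_def a_def corrector_coeff_def)
        qed
        then have "(\<Sum>j\<le>m. d j (m - j)) = (- t) ^ m / fact m * (\<Sum>j\<le>m. coeff (legendre m) j * \<sigma> ^ j)"
          by (simp add: sum_distrib_left)
        also have "(\<Sum>j\<le>m. coeff (legendre m) j * \<sigma> ^ j) = poly (legendre m) \<sigma>"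
          unfolding poly_altdef using degree_legendre[of m]
          by (intro sum.mono_neutral_right) (auto simp: coeff_eq_0)
        finally show ?thesis
          by (simp add: q_def)
      qed
      have "norm ((\<Sum>j\<le>m. ((- s) ^ j / fact j) *\<^sub>R dissipation_jet C j y) - q *\<^sub>R v m) \<le> K1 * t ^ Suc m"
      proof -
        have "q *\<^sub>R v m = (\<Sum>j\<le>m. \<Sum>k\<le>m. if k = m - j then d j k *\<^sub>R v m else 0)"
          by (simp add: sum.delta flip: diag scaleR_sum_left)
        moreover have "(\<Sum>j\<le>m. ((- s) ^ j / fact j) *\<^sub>R dissipation_jet C j y) = (\<Sum>j\<le>m. \<Sum>k\<le>m. d j k *\<^sub>R v (j + k))"
          by (simp add: jet_y d_def scaleR_sum_right)
        ultimately have "(\<Sum>j\<le>m. ((- s) ^ j / fact j) *\<^sub>R dissipation_jet C j y) - q *\<^sub>R v m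
            = (\<Sum>j\<le>m. \<Sum>k\<le>m. d j k *\<^sub>R v (j + k) - (if k = m - j then d j k *\<^sub>R v m else 0))"
          by (simp only: sum_subtractf)
        also have "norm \<dots> \<le> (\<Sum>j\<le>m. \<Sum>k\<le>m. \<bar>a k\<bar> * (1 + W) * t ^ Suc m)"
          by (intro sum_norm_le off_diag) simp_all
        finally show ?thesis
          by (simp only: K1_def sum_distrib_right)
      qed
      moreover have "norm (u - (\<Sum>j\<le>m. ((- s) ^ j / fact j) *\<^sub>R dissipation_jet C j y)) \<le> K0 * Y * t ^ Suc m"
      proof -
        have "K0 * s ^ Suc m * norm y \<le> K0 * t ^ Suc m * Y"
          using K0(1) s t \<open>norm y \<le> Y\<close> by (intro mult_mono mult_left_mono power_mono) simp_all
        with K0(2)[OF s(1,2), of y] show ?thesis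
          by (simp add: u_def mult_ac)
      qed
      ultimately have "norm (u - q *\<^sub>R v m) \<le> K0 * Y * t ^ Suc m + K1 * t ^ Suc m"
        by (rule norm_diff_triangle_le[rotated])
      then have uq: "norm (u - q *\<^sub>R v m) \<le> K2 * t ^ Suc m"
        by (simp add: K2_def algebra_simps)
      have qv: "\<bar>q\<bar> * norm (v m) \<le> t ^ m * (M * V)"
      proof -
        have "\<bar>q\<bar> = t ^ m / fact m * \<bar>poly (legendre m) \<sigma>\<bar>"
          using t by (simp add: q_def abs_mult power_abs)
        also have "\<dots> \<le> t ^ m / 1 * M"
          using t M(1) M(2)[OF \<sigma>] by (intro mult_mono frac_le) simp_all
        finally have "\<bar>q\<bar> * norm (v m) \<le> t ^ m / 1 * M * V"
          using v_le[of m] M(1) t unfolding V_def by (intro mult_mono) simp_all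
        then show ?thesis by (simp add: mult_ac)
      qed
      have "norm u \<le> \<bar>q\<bar> * norm (v m) + K2 * t ^ Suc m"
        using norm_triangle_ineq[of "q *\<^sub>R v m" "u - q *\<^sub>R v m"] uq by simp
      then have "(norm u)\<^sup>2 \<le> (\<bar>q\<bar> * norm (v m) + K2 * t ^ Suc m)\<^sup>2"
        by (rule power_mono) simp
      also have "\<dots> = q\<^sup>2 * (norm (v m))\<^sup>2 + 2 * (\<bar>q\<bar> * norm (v m)) * (K2 * t ^ Suc m) + (K2 * t ^ Suc m)\<^sup>2"
        by (simp add: power2_sum power_mult_distrib)
      also have "\<dots> \<le> q\<^sup>2 * (norm (v m))\<^sup>2 + 2 * (t ^ m * (M * V)) * (K2 * t ^ Suc m) + K2\<^sup>2 * t ^ (2 * m + 1)"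
      proof (intro add_mono mult_right_mono mult_left_mono qv order_refl)
        have "t ^ (2 * Suc m) \<le> t ^ (2 * m + 1)"
          using t by (intro power_decreasing) simp_all
        then have "K2\<^sup>2 * t ^ (2 * Suc m) \<le> K2\<^sup>2 * t ^ (2 * m + 1)"
          by (intro mult_left_mono) simp_all
        then show "(K2 * t ^ Suc m)\<^sup>2 \<le> K2\<^sup>2 * t ^ (2 * m + 1)"
          unfolding power_mult_distrib power_mult[symmetric] by (simp only: mult.commute[of 2])
      qed (use \<open>K2 \<ge> 0\<close> t in simp_all)
      also have "\<dots> = q\<^sup>2 * (norm (v m))\<^sup>2 + K3 * t ^ (2 * m + 1)"
        unfolding K3_def mult_2[of m] power_add power_Suc power_one_right by (simp only: algebra_simps)
      also have "\<dots> = poly w \<sigma>"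
        by (simp add: w_def q_def power_mult_distrib power_divide power_mult[symmetric] mult.commute[of m]
            power2_eq_square[of "poly _ _"])
      finally show "(norm (dissipation C \<cdot> evolution C (t * \<sigma>) \<cdot> y))\<^sup>2 \<le> poly w \<sigma>"
        by (simp add: u_def s_def)
    qed
    also have "poly_integral w = t ^ (2 * m) * (decay_factor m * (norm (v m))\<^sup>2) + K3 * t ^ (2 * m + 1)"
      by (simp add: w_def poly_integral_add poly_integral_smult poly_integral_legendre_power2
          legendre_const_eq poly_integral_const)
    also have "t * \<dots> = t ^ (2 * m + 1) * (decay_factor m * (norm (v m))\<^sup>2 + K3 * t)"
      by (simp add: algebra_simps)
    also have "\<dots> \<le> t ^ (2 * m + 1) * (decay_factor m * (norm (v m))\<^sup>2 + K * t)"
      using t \<open>K3 \<le> K\<close> by (intro mult_left_mono add_left_mono mult_right_mono) simp_all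
    finally show ?thesis
      using norm_y by (auto simp: v_def)
  qed
  then show ?thesis
    using that \<open>K \<ge> 0\<close> by blast
qed


section \<open>Asymptotics of the operator norm\<close>

lemma jets_small_if_not_coercive:
  assumes "accretive C" "\<not> hc_coercive C k" "\<delta> > 0"
  obtains x where "norm x = 1" "\<And>j. j \<le> k \<Longrightarrow> (norm (dissipation_jet C j x))\<^sup>2 \<le> \<delta>"
proof -
  obtain x where x: "norm x = 1" "(\<Sum>j\<le>k. (norm (dissipation_jet C j x))\<^sup>2) < \<delta>"
    using assms by (auto simp: hc_coercive_iff not_le)
  have "(norm (dissipation_jet C j x))\<^sup>2 \<le> \<delta>" if "j \<le> k" for j
    using member_le_sum[of j "{..k}" "\<lambda>j. (norm (dissipation_jet C j x))\<^sup>2"] that x by simp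
  with x show ?thesis using that by blast
qed

text \<open>
  The energy loss of the corrected vector bounds the defect \<open>d = 1 - \<parallel>P(t)\<parallel>\<^sup>2\<close> times \<open>\<parallel>y\<parallel>\<^sup>2\<close> from above.
  A crude bound \<open>d = O(t\<^bsup>2m+1\<^esup>)\<close> then shows that \<open>\<parallel>y\<parallel>\<^sup>2 \<ge> 1 - K t\<close> can be replaced by \<open>1\<close>,
  at the cost of a term of order \<open>t\<^bsup>2m+2\<^esup>\<close>.
\<close>

lemma evolution_defect_upper:
  assumes C: "accretive C"
  obtains K t0 where "t0 > 0" "t0 \<le> 1" "K \<ge> 0"
    "\<And>t x. \<lbrakk>0 \<le> t; t \<le> t0; norm x = 1; \<And>j. j < m \<Longrightarrow> (norm (dissipation_jet C j x))\<^sup>2 \<le> t ^ (2 * m + 2)\<rbrakk>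
      \<Longrightarrow> 1 - (norm (evolution C t))\<^sup>2 \<le> 2 * t ^ (2 * m + 1) * (decay_factor m * (norm (dissipation_jet C m x))\<^sup>2 + K * t)"
proof -
  obtain K where K: "K \<ge> 0"
    "\<And>t x. \<lbrakk>0 \<le> t; t \<le> 1; norm x = 1; \<And>j. j < m \<Longrightarrow> norm (dissipation_jet C j x) \<le> t ^ Suc m\<rbrakk> \<Longrightarrow>
      \<exists>y. 1 - K * t \<le> (norm y)\<^sup>2 \<and>
        energy_loss C t y \<le> t ^ (2 * m + 1) * (decay_factor m * (norm (dissipation_jet C m x))\<^sup>2 + K * t)"
    using energy_loss_corrected[OF C, of m] by blast
  define V where "V = norm (dissipation C * C ^ m)"
  define B where "B = decay_factor m * V\<^sup>2 + K"
  have "B \<ge> 0"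
    using K(1) decay_factor_pos[of m] by (simp add: B_def)
  define t0 where "t0 = 1 / (2 * K + 1)"
  have "1 - (norm (evolution C t))\<^sup>2
      \<le> 2 * t ^ (2 * m + 1) * (decay_factor m * (norm (dissipation_jet C m x))\<^sup>2 + (K + 2 * K * B) * t)"
    if t: "0 \<le> t" "t \<le> t0" and x: "norm x = 1"
      and small: "\<And>j. j < m \<Longrightarrow> (norm (dissipation_jet C j x))\<^sup>2 \<le> t ^ (2 * m + 2)" for t x
  proof -
    define d where "d = 1 - (norm (evolution C t))\<^sup>2"
    define g where "g = decay_factor m * (norm (dissipation_jet C m x))\<^sup>2"
    have "t0 \<le> 1" "K * t0 \<le> 1 / 2"
      using K(1) by (simp_all add: t0_def field_simps)
    then have "t \<le> 1" "K * t \<le> 1 / 2"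
      using t mult_left_mono[OF t(2) K(1)] by simp_all
    have "d \<ge> 0"
      using norm_evolution_le_1[OF C t(1)] by (simp add: d_def power_le_one)
    have "norm (dissipation_jet C j x) \<le> t ^ Suc m" if "j < m" for j
    proof (rule power2_le_imp_le)
      have "(t ^ Suc m)\<^sup>2 = t ^ (2 * m + 2)"
        by (simp only: power_mult[symmetric]) (simp add: mult.commute)
      then show "(norm (dissipation_jet C j x))\<^sup>2 \<le> (t ^ Suc m)\<^sup>2"
        using small[OF that] by simp
    qed (use t in simp)
    then obtain y where y: "1 - K * t \<le> (norm y)\<^sup>2"
      "energy_loss C t y \<le> t ^ (2 * m + 1) * (g + K * t)"
      using K(2)[OF t(1) \<open>t \<le> 1\<close> x] by (auto simp: g_def)
    have "(norm (evolution C t \<cdot> y))\<^sup>2 \<le> (norm (evolution C t) * norm y)\<^sup>2"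
      by (intro power_mono norm_op_apply_le) simp
    then have "d * (norm y)\<^sup>2 \<le> 2 * energy_loss C t y"
      by (simp add: d_def energy_loss_def algebra_simps power_mult_distrib)
    moreover have "d * (1 - K * t) \<le> d * (norm y)\<^sup>2"
      by (intro mult_left_mono y \<open>d \<ge> 0\<close>)
    ultimately have main: "d * (1 - K * t) \<le> 2 * (t ^ (2 * m + 1) * (g + K * t))"
      using y(2) by linarith
    have "g + K * t \<le> B"
    proof -
      have "norm (dissipation_jet C m x) \<le> V"
        using norm_dissipation_jet_le[of C m x] by (simp add: V_def x)
      then have "g \<le> decay_factor m * V\<^sup>2"
        unfolding g_def using decay_factor_pos[of m] by (intro mult_left_mono power_mono) simp_all
      moreover have "K * t \<le> K"
        using K(1) t \<open>t \<le> 1\<close> by (simp add: mult_left_le)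
      ultimately show ?thesis by (simp add: B_def)
    qed
    then have "t ^ (2 * m + 1) * (g + K * t) \<le> t ^ (2 * m + 1) * B"
      using t by (intro mult_left_mono) simp_all
    moreover have "d * (1 / 2) \<le> d * (1 - K * t)"
      using \<open>K * t \<le> 1 / 2\<close> \<open>d \<ge> 0\<close> by (intro mult_left_mono) simp_all
    ultimately have "d \<le> 4 * (t ^ (2 * m + 1) * B)"
      using main by linarith
    then have "K * t * d \<le> K * t * (4 * (t ^ (2 * m + 1) * B))"
      using K(1) t by (intro mult_left_mono) simp_all
    with main have "d \<le> 2 * (t ^ (2 * m + 1) * (g + K * t)) + K * t * (4 * (t ^ (2 * m + 1) * B))"
      by (simp only: right_diff_distrib mult_1_right mult_ac)
    also have "\<dots> = 2 * t ^ (2 * m + 1) * (g + (K + 2 * K * B) * t)"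
      by (simp only: algebra_simps)
    finally show ?thesis
      by (simp add: d_def g_def)
  qed
  moreover have "t0 > 0" "t0 \<le> 1" "K + 2 * K * B \<ge> 0"
    using K(1) \<open>B \<ge> 0\<close> by (simp_all add: t0_def)
  ultimately show ?thesis
    using that by blast
qed

lemma hc_inf_eq:
  "hc_inf C m \<delta> = Inf {(norm (dissipation_jet C m x))\<^sup>2 | x.
    norm x = 1 \<and> (\<forall>j<m. (norm (dissipation_jet C j x))\<^sup>2 \<le> \<delta>)}"
  by (simp add: hc_inf_def dissipation_jet_def dissipation_def)

lemma hc_inf_le:
  assumes "norm x = 1" "\<And>j. j < m \<Longrightarrow> (norm (dissipation_jet C j x))\<^sup>2 \<le> \<delta>"
  shows "hc_inf C m \<delta> \<le> (norm (dissipation_jet C m x))\<^sup>2"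
  unfolding hc_inf_eq using assms by (intro cInf_lower) (auto intro!: bdd_belowI[of _ 0])

text \<open>
  Minimality of the index makes the set in the definition of \<open>hc_inf\<close> nonempty.
\<close>

lemma ex_jets_small:
  fixes C :: "'a::nonzero_complex_hilbert op"
  assumes "accretive C" "has_hc_index C m" "\<delta> > 0"
  obtains x where "norm x = 1" "\<And>j. j < m \<Longrightarrow> (norm (dissipation_jet C j x))\<^sup>2 \<le> \<delta>"
proof (cases m)
  case 0
  obtain x :: 'a where "x \<noteq> 0"
    using ex_nonzero by blast
  then have "norm (sgn x) = 1"
    by (simp add: norm_sgn)
  then show ?thesis
    using that 0 by blast
next
  case (Suc k)
  then have "\<not> hc_coercive C k"
    using assms(2) by (simp add: has_hc_index_def)
  from jets_small_if_not_coercive[OF assms(1) this assms(3)] show ?thesis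
    using that Suc by (metis less_Suc_eq_le)
qed

lemma le_hc_inf:
  assumes "accretive C" "has_hc_index C m" "\<delta> > 0"
    and "\<And>x. \<lbrakk>norm x = 1; \<And>j. j < m \<Longrightarrow> (norm (dissipation_jet C j x))\<^sup>2 \<le> \<delta>\<rbrakk>
      \<Longrightarrow> b \<le> (norm (dissipation_jet C m x))\<^sup>2"
  shows "b \<le> hc_inf C m \<delta>"
  unfolding hc_inf_eq
proof (rule cInf_greatest)
  show "{(norm (dissipation_jet C m x))\<^sup>2 |x. norm x = 1 \<and> (\<forall>j<m. (norm (dissipation_jet C j x))\<^sup>2 \<le> \<delta>)} \<noteq> {}"
    by (rule ex_jets_small[OF assms(1-3)]) blast
qed (use assms(4) in auto)

text \<open>
  Being antitone and bounded, \<open>hc_inf C m\<close> converges to its supremum. Coercivity makes the limit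
  positive: if the lower jets are small, then the top one must carry at least half of the coercivity constant.
\<close>

lemma hc_inf_tendsto:
  assumes C: "accretive C" and m: "has_hc_index C m"
  obtains l where "l > 0" "(hc_inf C m \<longlongrightarrow> l) (at_right 0)" "\<And>\<delta>. \<delta> > 0 \<Longrightarrow> hc_inf C m \<delta> \<le> l"
proof -
  define l where "l = (SUP \<delta>\<in>{0<..}. hc_inf C m \<delta>)"
  have antimono: "hc_inf C m \<delta>' \<le> hc_inf C m \<delta>" if "0 < \<delta>" "\<delta> \<le> \<delta>'" for \<delta> \<delta>'
    using that by (intro le_hc_inf[OF C m] hc_inf_le) (auto intro: order_trans)
  have "hc_inf C m \<delta> \<le> (norm (dissipation C * C ^ m))\<^sup>2" if "0 < \<delta>" for \<delta>
  proof -
    obtain x where x: "norm x = 1" "\<And>j. j < m \<Longrightarrow> (norm (dissipation_jet C j x))\<^sup>2 \<le> \<delta>"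
      using ex_jets_small[OF C m \<open>0 < \<delta>\<close>] by blast
    then have "hc_inf C m \<delta> \<le> (norm (dissipation_jet C m x))\<^sup>2"
      by (rule hc_inf_le)
    also have "\<dots> \<le> (norm (dissipation C * C ^ m))\<^sup>2"
      using norm_dissipation_jet_le[of C m x] x by (intro power_mono) simp_all
    finally show ?thesis .
  qed
  then have bdd: "bdd_above (hc_inf C m ` {0<..})"
    by (auto intro!: bdd_aboveI)
  have le_l: "hc_inf C m \<delta> \<le> l" if "\<delta> > 0" for \<delta>
    unfolding l_def using that by (intro cSUP_upper bdd) simp
  have "(hc_inf C m \<longlongrightarrow> l) (at_right 0)"
  proof (rule order_tendstoI)
    fix b
    assume "b < l"
    then obtain \<delta> where "\<delta> > 0" "b < hc_inf C m \<delta>"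
      unfolding l_def using less_cSUP_iff[OF _ bdd, of b] by auto
    then have "\<forall>\<delta>'>0. \<delta>' < \<delta> \<longrightarrow> b < hc_inf C m \<delta>'"
      using antimono by (metis less_le_trans less_imp_le)
    with \<open>\<delta> > 0\<close> show "\<forall>\<^sub>F \<delta> in at_right 0. b < hc_inf C m \<delta>"
      unfolding eventually_at_right_field by blast
  next
    fix b
    assume "l < b"
    then show "\<forall>\<^sub>F \<delta> in at_right 0. hc_inf C m \<delta> < b"
      unfolding eventually_at_right_field using le_l by (metis le_less_trans zero_less_one)
  qed
  moreover have "l > 0"
  proof -
    obtain \<kappa> where \<kappa>: "\<kappa> > 0"
      "\<And>x. norm x = 1 \<Longrightarrow> \<kappa> \<le> (\<Sum>j\<le>m. (norm (dissipation_jet C j x))\<^sup>2)"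
      using m by (auto simp: has_hc_index_def hc_coercive_iff[OF C])
    define \<delta> where "\<delta> = \<kappa> / (2 * (real m + 1))"
    have "\<delta> > 0" "real m * \<delta> \<le> \<kappa> / 2"
      using \<kappa>(1) by (simp_all add: \<delta>_def field_simps)
    have "\<kappa> / 2 \<le> hc_inf C m \<delta>"
    proof (rule le_hc_inf[OF C m \<open>\<delta> > 0\<close>])
      fix x :: 'a
      assume x: "norm x = 1" "\<And>j. j < m \<Longrightarrow> (norm (dissipation_jet C j x))\<^sup>2 \<le> \<delta>"
      have "\<kappa> \<le> (\<Sum>j<m. (norm (dissipation_jet C j x))\<^sup>2) + (norm (dissipation_jet C m x))\<^sup>2"
        using \<kappa>(2)[OF x(1)] by (simp flip: lessThan_Suc_atMost)
      moreover have "(\<Sum>j<m. (norm (dissipation_jet C j x))\<^sup>2) \<le> real m * \<delta>"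
        using sum_bounded_above[of "{..<m}" _ \<delta>] x(2) by simp
      ultimately show "\<kappa> / 2 \<le> (norm (dissipation_jet C m x))\<^sup>2"
        using \<open>real m * \<delta> \<le> \<kappa> / 2\<close> by linarith
    qed
    with le_l[OF \<open>\<delta> > 0\<close>] \<kappa>(1) show ?thesis
      by linarith
  qed
  ultimately show ?thesis
    using that le_l by blast
qed

lemma eventually_at_right_mult_le:
  assumes "b > 0"
  shows "\<forall>\<^sub>F t in at_right 0. K * t \<le> (b::real)"
proof -
  have "((\<lambda>t. K * t) \<longlongrightarrow> K * 0) (at_right 0)"
    by (intro tendsto_intros)
  then have "\<forall>\<^sub>F t in at_right 0. K * t < b"
    using assms by (intro order_tendstoD(2)) simp_all
  then show ?thesis
    by eventually_elim simp
qed

text \<open>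
  If all lower jets of \<open>x\<close> are at most \<open>\<delta>\<close>, then the jet of order \<open>m\<close> is at least the infimum. Otherwise some
  jet of order \<open>j < m\<close> exceeds \<open>\<delta>\<close> and already causes a loss of order \<open>t\<^bsup>2j+1\<^esup>\<close>, which
  dominates \<open>t\<^bsup>2m+1\<^esup>\<close>.
\<close>

lemma eventually_energy_loss_ge:
  assumes C: "accretive C" and m: "has_hc_index C m"
    and \<delta>: "\<delta> > 0" and b: "b < decay_factor m * hc_inf C m \<delta>"
  shows "\<forall>\<^sub>F t in at_right 0. \<forall>x. norm x = 1 \<longrightarrow> b * t ^ (2 * m + 1) \<le> energy_loss C t x"
proof -
  have "\<exists>K. \<forall>t x. 0 \<le> t \<longrightarrow> t \<le> 1 \<longrightarrow> norm x = 1 \<longrightarrow>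
    t ^ (2 * k + 1) * (decay_factor k * (norm (dissipation_jet C k x))\<^sup>2 - K * t) \<le> energy_loss C t x" for k
    using energy_loss_lower_bound[OF C, of k] by metis
  then obtain K where K: "\<And>k t x. \<lbrakk>0 \<le> t; t \<le> 1; norm x = 1\<rbrakk> \<Longrightarrow>
    t ^ (2 * k + 1) * (decay_factor k * (norm (dissipation_jet C k x))\<^sup>2 - K k * t) \<le> energy_loss C t x"
    by metis
  have "\<forall>\<^sub>F t in at_right 0. \<forall>j\<in>{..<m}. (\<bar>b\<bar> + K j) * t \<le> decay_factor j * \<delta>"
    by (intro eventually_ball_finite ballI eventually_at_right_mult_le mult_pos_pos decay_factor_pos \<delta>)
      simp
  moreover have "\<forall>\<^sub>F t in at_right 0. K m * t \<le> decay_factor m * hc_inf C m \<delta> - b"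
    using b by (intro eventually_at_right_mult_le) simp
  moreover have "\<forall>\<^sub>F t in at_right 0. 1 * t \<le> (1::real)"
    by (rule eventually_at_right_mult_le) simp
  moreover have "\<forall>\<^sub>F t in at_right 0. t > (0::real)"
    by (rule eventually_at_right_less)
  ultimately show ?thesis
  proof eventually_elim
    case (elim t)
    show ?case
    proof (intro allI impI)
      fix x :: 'a
      assume x: "norm x = 1"
      show "b * t ^ (2 * m + 1) \<le> energy_loss C t x"
      proof (cases "\<forall>j<m. (norm (dissipation_jet C j x))\<^sup>2 \<le> \<delta>")
        case True
        then have "hc_inf C m \<delta> \<le> (norm (dissipation_jet C m x))\<^sup>2"
          using x by (intro hc_inf_le) auto
        then have "decay_factor m * hc_inf C m \<delta> \<le> decay_factor m * (norm (dissipation_jet C m x))\<^sup>2"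
          using decay_factor_pos[of m] by (intro mult_left_mono) simp_all
        then have "b \<le> decay_factor m * (norm (dissipation_jet C m x))\<^sup>2 - K m * t"
          using elim by linarith
        then have "t ^ (2 * m + 1) * b \<le> t ^ (2 * m + 1) * (decay_factor m * (norm (dissipation_jet C m x))\<^sup>2 - K m * t)"
          using elim by (intro mult_left_mono) simp_all
        also have "\<dots> \<le> energy_loss C t x"
          using elim x by (intro K) simp_all
        finally show ?thesis by (simp add: mult.commute)
      next
        case False
        then obtain j where j: "j < m" "\<delta> < (norm (dissipation_jet C j x))\<^sup>2"
          by (auto simp: not_le)
        have "t ^ (2 * (m - j)) \<le> t ^ 1"
          using j(1) elim by (intro power_decreasing) simp_all
        then have "b * t ^ (2 * (m - j)) \<le> \<bar>b\<bar> * t"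
          using elim by (intro mult_mono) simp_all
        also have "\<dots> \<le> decay_factor j * (norm (dissipation_jet C j x))\<^sup>2 - K j * t"
        proof -
          have "(\<bar>b\<bar> + K j) * t \<le> decay_factor j * \<delta>"
            using elim j(1) by auto
          also have "\<dots> \<le> decay_factor j * (norm (dissipation_jet C j x))\<^sup>2"
            using j decay_factor_pos[of j] by (intro mult_left_mono) simp_all
          finally show ?thesis
            by (simp add: algebra_simps)
        qed
        finally have "t ^ (2 * j + 1) * (b * t ^ (2 * (m - j)))
            \<le> t ^ (2 * j + 1) * (decay_factor j * (norm (dissipation_jet C j x))\<^sup>2 - K j * t)"
          using elim by (intro mult_left_mono) simp_all
        moreover have "2 * m + 1 = (2 * j + 1) + 2 * (m - j)"
          using j(1) by simp
        then have "b * t ^ (2 * m + 1) = t ^ (2 * j + 1) * (b * t ^ (2 * (m - j)))"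
          by (simp only: power_add mult_ac)
        ultimately have "b * t ^ (2 * m + 1)
            \<le> t ^ (2 * j + 1) * (decay_factor j * (norm (dissipation_jet C j x))\<^sup>2 - K j * t)"
          by (simp only:)
        also have "\<dots> \<le> energy_loss C t x"
          using elim x by (intro K) simp_all
        finally show ?thesis .
      qed
    qed
  qed
qed

lemma evolution_defect_ge:
  fixes C :: "'a::nonzero_complex_hilbert op"
  assumes "\<And>x. norm x = 1 \<Longrightarrow> b \<le> energy_loss C t x"
  shows "2 * b \<le> 1 - (norm (evolution C t))\<^sup>2"
proof -
  have le: "(norm (evolution C t \<cdot> x))\<^sup>2 \<le> 1 - 2 * b" if "norm x = 1" for x
    using assms[OF that] that by (simp add: energy_loss_def field_simps)
  obtain x :: 'a where "x \<noteq> 0"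
    using ex_nonzero by blast
  then have "(norm (evolution C t \<cdot> sgn x))\<^sup>2 \<le> 1 - 2 * b"
    by (intro le) (simp add: norm_sgn)
  then have "0 \<le> 1 - 2 * b"
    using zero_le_power2[of "norm (evolution C t \<cdot> sgn x)"] by linarith
  have "norm (evolution C t) \<le> sqrt (1 - 2 * b)"
    using \<open>0 \<le> 1 - 2 * b\<close> le by (intro op_norm_le) (simp_all add: real_le_rsqrt)
  then have "(norm (evolution C t))\<^sup>2 \<le> 1 - 2 * b"
    using power_mono[OF _ norm_ge_zero, of "evolution C t" "sqrt (1 - 2 * b)" 2] \<open>0 \<le> 1 - 2 * b\<close>
    by (simp only: real_sqrt_pow2)
  then show ?thesis by simp
qed

text \<open>
  The lower bound comes from \<open>eventually_energy_loss_ge\<close> with a fixed \<open>\<delta>\<close>. For the upper bound the test vector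
  depends on \<open>t\<close>: it nearly attains the infimum for \<open>\<delta> = t\<^bsup>2m+2\<^esup>\<close>, and this infimum
  stays below the limit.
\<close>

lemma evolution_defect_square_tendsto:
  assumes C: "accretive C" and m: "has_hc_index C m"
  shows "hc_const C m > 0"
    and "((\<lambda>t. (1 - (norm (evolution C t))\<^sup>2) / t ^ (2 * m + 1)) \<longlongrightarrow> 2 * hc_const C m) (at_right 0)"
proof -
  obtain l where l: "l > 0" "(hc_inf C m \<longlongrightarrow> l) (at_right 0)" "\<And>\<delta>. \<delta> > 0 \<Longrightarrow> hc_inf C m \<delta> \<le> l"
    using hc_inf_tendsto[OF C m] by blast
  have "Lim (at_right 0) (hc_inf C m) = l"
    using l(2) by (intro tendsto_Lim) simp_all
  then have const: "hc_const C m = decay_factor m * l"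
    by (simp add: hc_const_def decay_factor_def)
  then show "hc_const C m > 0"
    using l(1) decay_factor_pos by simp
  show "((\<lambda>t. (1 - (norm (evolution C t))\<^sup>2) / t ^ (2 * m + 1)) \<longlongrightarrow> 2 * hc_const C m) (at_right 0)"
  proof (rule order_tendstoI)
    fix b
    assume "b < 2 * hc_const C m"
    then have "b / (2 * decay_factor m) < l"
      using decay_factor_pos[of m] by (simp add: const field_simps)
    then have "\<forall>\<^sub>F \<delta> in at_right 0. b / (2 * decay_factor m) < hc_inf C m \<delta>"
      by (rule order_tendstoD(1)[OF l(2)])
    then obtain \<delta> where \<delta>: "\<delta> > 0" "b / (2 * decay_factor m) < hc_inf C m \<delta>"
      unfolding eventually_at_right_field by (metis dense)
    then have "b / 2 < decay_factor m * hc_inf C m \<delta>"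
      using decay_factor_pos[of m] by (simp add: field_simps)
    then obtain b' where b': "b / 2 < b'" "b' < decay_factor m * hc_inf C m \<delta>"
      using dense by blast
    have "\<forall>\<^sub>F t in at_right 0. t > (0::real)"
      by (rule eventually_at_right_less)
    with eventually_energy_loss_ge[OF C m \<delta>(1) b'(2)]
    show "\<forall>\<^sub>F t in at_right 0. b < (1 - (norm (evolution C t))\<^sup>2) / t ^ (2 * m + 1)"
    proof eventually_elim
      case (elim t)
      have "b * t ^ (2 * m + 1) < 2 * b' * t ^ (2 * m + 1)"
        using b'(1) elim by (intro mult_strict_right_mono) simp_all
      also have "\<dots> \<le> 1 - (norm (evolution C t))\<^sup>2"
        using evolution_defect_ge[of "b' * t ^ (2 * m + 1)" C t] elim by simp
      finally show ?case
        using elim by (simp add: pos_less_divide_eq)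
    qed
  next
    fix b
    assume b: "2 * hc_const C m < b"
    obtain K t0 where K: "t0 > 0" "t0 \<le> 1" "K \<ge> 0"
      "\<And>t x. \<lbrakk>0 \<le> t; t \<le> t0; norm x = 1; \<And>j. j < m \<Longrightarrow> (norm (dissipation_jet C j x))\<^sup>2 \<le> t ^ (2 * m + 2)\<rbrakk>
        \<Longrightarrow> 1 - (norm (evolution C t))\<^sup>2 \<le> 2 * t ^ (2 * m + 1) * (decay_factor m * (norm (dissipation_jet C m x))\<^sup>2 + K * t)"
      using evolution_defect_upper[OF C, of m] by metis
    define e where "e = (b - 2 * hc_const C m) / 4"
    have "e > 0"
      using b by (simp add: e_def)
    have "\<forall>\<^sub>F t in at_right 0. 1 * t \<le> t0"
      by (rule eventually_at_right_mult_le) (rule K)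
    moreover have "\<forall>\<^sub>F t in at_right 0. (decay_factor m + K) * t \<le> e"
      by (rule eventually_at_right_mult_le) fact
    moreover have "\<forall>\<^sub>F t in at_right 0. t > (0::real)"
      by (rule eventually_at_right_less)
    ultimately show "\<forall>\<^sub>F t in at_right 0. (1 - (norm (evolution C t))\<^sup>2) / t ^ (2 * m + 1) < b"
    proof eventually_elim
      case (elim t)
      have "\<exists>x. norm x = 1 \<and> (\<forall>j<m. (norm (dissipation_jet C j x))\<^sup>2 \<le> t ^ (2 * m + 2)) \<and>
          (norm (dissipation_jet C m x))\<^sup>2 < l + t"
      proof (rule ccontr)
        assume "\<not> ?thesis"
        then have "l + t \<le> hc_inf C m (t ^ (2 * m + 2))"
          using elim by (intro le_hc_inf[OF C m]) (auto simp: not_less)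
        with l(3)[of "t ^ (2 * m + 2)"] elim show False by simp
      qed
      then obtain x where x: "norm x = 1" "\<And>j. j < m \<Longrightarrow> (norm (dissipation_jet C j x))\<^sup>2 \<le> t ^ (2 * m + 2)"
          "(norm (dissipation_jet C m x))\<^sup>2 < l + t"
        by blast
      have "decay_factor m * (norm (dissipation_jet C m x))\<^sup>2 \<le> decay_factor m * (l + t)"
        using decay_factor_pos[of m] x(3) by (intro mult_left_mono) simp_all
      then have "decay_factor m * (norm (dissipation_jet C m x))\<^sup>2 + K * t \<le> hc_const C m + e"
        using elim by (simp add: const algebra_simps)
      then have "2 * t ^ (2 * m + 1) * (decay_factor m * (norm (dissipation_jet C m x))\<^sup>2 + K * t)
          \<le> 2 * t ^ (2 * m + 1) * (hc_const C m + e)"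
        using elim by (intro mult_left_mono) simp_all
      moreover have "1 - (norm (evolution C t))\<^sup>2
          \<le> 2 * t ^ (2 * m + 1) * (decay_factor m * (norm (dissipation_jet C m x))\<^sup>2 + K * t)"
        using elim x by (intro K(4)) simp_all
      moreover have "2 * t ^ (2 * m + 1) * (hc_const C m + e) < b * t ^ (2 * m + 1)"
      proof -
        have "2 * (hc_const C m + e) < b"
          using \<open>e > 0\<close> by (simp add: e_def field_simps)
        then have "2 * (hc_const C m + e) * t ^ (2 * m + 1) < b * t ^ (2 * m + 1)"
          using elim by (intro mult_strict_right_mono) simp_all
        then show ?thesis
          by (simp only: mult_ac)
      qed
      ultimately have "1 - (norm (evolution C t))\<^sup>2 < b * t ^ (2 * m + 1)"
        by linarith
      then show ?case
        using elim by (simp add: pos_divide_less_eq)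
    qed
  qed
qed

text \<open>
  Divide by \<open>1 + \<parallel>P(t)\<parallel>\<close>, which tends to \<open>2\<close>.
\<close>

lemma evolution_defect_tendsto:
  assumes C: "accretive C" and m: "has_hc_index C m"
  shows "((\<lambda>t. (1 - norm (evolution C t)) / t ^ (2 * m + 1)) \<longlongrightarrow> hc_const C m) (at_right 0)"
proof -
  let ?N = "\<lambda>t. norm (evolution C t)"
  note lim = evolution_defect_square_tendsto(2)[OF C m]
  have "((\<lambda>t. 1 - (1 - (?N t)\<^sup>2) / t ^ (2 * m + 1) * t ^ (2 * m + 1)) \<longlongrightarrow>
      1 - 2 * hc_const C m * 0 ^ (2 * m + 1)) (at_right 0)"
    by (intro tendsto_intros lim)
  moreover have "\<forall>\<^sub>F t in at_right 0. 1 - (1 - (?N t)\<^sup>2) / t ^ (2 * m + 1) * t ^ (2 * m + 1) = (?N t)\<^sup>2"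
    using eventually_at_right_less[of "0::real"] by eventually_elim simp
  ultimately have "((\<lambda>t. (?N t)\<^sup>2) \<longlongrightarrow> 1 - 2 * hc_const C m * 0 ^ (2 * m + 1)) (at_right 0)"
    by (rule Lim_transform_eventually)
  then have "((\<lambda>t. sqrt ((?N t)\<^sup>2)) \<longlongrightarrow> sqrt 1) (at_right 0)"
    by (intro tendsto_real_sqrt) simp
  then have "(?N \<longlongrightarrow> 1) (at_right 0)"
    by simp
  with lim have "((\<lambda>t. (1 - (?N t)\<^sup>2) / t ^ (2 * m + 1) / (1 + ?N t)) \<longlongrightarrow> 2 * hc_const C m / (1 + 1)) (at_right 0)"
    by (intro tendsto_intros) simp_all
  moreover have "(1 - (?N t)\<^sup>2) / t ^ (2 * m + 1) / (1 + ?N t) = (1 - ?N t) / t ^ (2 * m + 1)" for t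
  proof -
    have "1 - (?N t)\<^sup>2 = (1 - ?N t) * (1 + ?N t)"
      by (simp add: power2_eq_square algebra_simps)
    moreover have "1 + ?N t \<noteq> 0"
      using norm_ge_zero[of "evolution C t"] by linarith
    ultimately show ?thesis
      by simp
  qed
  ultimately show ?thesis
    by simp
qed


section \<open>Comparing exponents and exponential stability\<close>

lemma smallo_iff_defect_tendsto:
  fixes N g :: "real \<Rightarrow> real"
  assumes "\<And>t. t > 0 \<Longrightarrow> g t > 0"
  shows "(\<lambda>t. N t - (1 - c * g t)) \<in> o[at_right 0](g) \<longleftrightarrow> ((\<lambda>t. (1 - N t) / g t) \<longlongrightarrow> c) (at_right 0)"
proof -
  have pos: "\<forall>\<^sub>F t in at_right 0. g t > 0"
    using eventually_at_right_less[of "0::real"] by eventually_elim (rule assms)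
  have "(\<lambda>t. N t - (1 - c * g t)) \<in> o[at_right 0](g) \<longleftrightarrow>
      ((\<lambda>t. (N t - (1 - c * g t)) / g t) \<longlongrightarrow> 0) (at_right 0)"
    using pos by (auto intro!: smalloI_tendsto dest: smalloD_tendsto elim: eventually_mono)
  also have "\<dots> \<longleftrightarrow> ((\<lambda>t. c - (1 - N t) / g t) \<longlongrightarrow> 0) (at_right 0)"
    by (rule tendsto_cong, use pos in eventually_elim) (simp add: field_simps)
  also have "\<dots> \<longleftrightarrow> ((\<lambda>t. (1 - N t) / g t) \<longlongrightarrow> c) (at_right 0)"
  proof
    assume "((\<lambda>t. c - (1 - N t) / g t) \<longlongrightarrow> 0) (at_right 0)"
    from tendsto_diff[OF tendsto_const[of c] this] show "((\<lambda>t. (1 - N t) / g t) \<longlongrightarrow> c) (at_right 0)"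
      by simp
  next
    assume "((\<lambda>t. (1 - N t) / g t) \<longlongrightarrow> c) (at_right 0)"
    from tendsto_diff[OF tendsto_const[of c] this] show "((\<lambda>t. c - (1 - N t) / g t) \<longlongrightarrow> 0) (at_right 0)"
      by simp
  qed
  finally show ?thesis .
qed

lemma tendsto_powr_at_right_0:
  assumes "a > 0"
  shows "((\<lambda>t. t powr a) \<longlongrightarrow> 0) (at_right (0::real))"
proof -
  have "((\<lambda>t. t powr a) \<longlongrightarrow> 0 powr a) (at_right (0::real))"
    using assms eventually_at_right_less[of "0::real"]
    by (intro tendsto_powr' tendsto_intros) (auto elim: eventually_mono)
  then show ?thesis by simp
qed

text \<open>
  A function that has exact order \<open>a\<close> at \<open>0\<close> cannot be of a strictly higher order \<open>b\<close>.
\<close>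

lemma powr_order_le:
  fixes f :: "real \<Rightarrow> real"
  assumes a: "((\<lambda>t. f t / t powr a) \<longlongrightarrow> c) (at_right 0)" and "c \<noteq> 0"
    and b: "((\<lambda>t. f t / t powr b) \<longlongrightarrow> d) (at_right 0)"
  shows "b \<le> a"
proof (rule ccontr)
  assume "\<not> b \<le> a"
  then have "((\<lambda>t. f t / t powr b * t powr (b - a)) \<longlongrightarrow> d * 0) (at_right 0)"
    by (intro tendsto_mult b tendsto_powr_at_right_0) simp
  moreover have "\<forall>\<^sub>F t in at_right 0. f t / t powr b * t powr (b - a) = f t / t powr a"
    using eventually_at_right_less[of "0::real"] by eventually_elim (simp add: powr_diff)
  ultimately have "((\<lambda>t. f t / t powr a) \<longlongrightarrow> d * 0) (at_right 0)"
    by (rule Lim_transform_eventually)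
  with a \<open>c \<noteq> 0\<close> show False
    using tendsto_unique[of "at_right (0::real)"] by fastforce
qed

text \<open>
  Without coercivity of order \<open>m\<close> the jets up to and including order \<open>m\<close> can all be made smaller than any power of
  \<open>t\<close>, so that the corrected vectors bound the defect by \<open>O(t\<^sup>m)\<close>. For \<open>m > a\<close> this is
  incompatible with an exact order \<open>a\<close>.
\<close>

lemma ex_hc_coercive:
  fixes C :: "'a::nonzero_complex_hilbert op"
  assumes C: "accretive C" and "c > 0"
    and lim: "((\<lambda>t. (1 - norm (evolution C t)) / t powr a) \<longlongrightarrow> c) (at_right 0)"
  shows "\<exists>m. hc_coercive C m"
proof (rule ccontr)
  assume none: "\<nexists>m. hc_coercive C m"
  obtain m :: nat where m: "a < real m"
    using reals_Archimedean2 by blast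
  obtain K t0 where K: "t0 > 0" "t0 \<le> 1" "K \<ge> 0"
    "\<And>t x. \<lbrakk>0 \<le> t; t \<le> t0; norm x = 1; \<And>j. j < m \<Longrightarrow> (norm (dissipation_jet C j x))\<^sup>2 \<le> t ^ (2 * m + 2)\<rbrakk>
      \<Longrightarrow> 1 - (norm (evolution C t))\<^sup>2 \<le> 2 * t ^ (2 * m + 1) * (decay_factor m * (norm (dissipation_jet C m x))\<^sup>2 + K * t)"
    using evolution_defect_upper[OF C, of m] by metis
  have bound: "1 - norm (evolution C t) \<le> 2 * (decay_factor m + K) * t powr m" if t: "0 < t" "t \<le> t0" for t
  proof -
    have "t \<le> 1"
      using t K by simp
    obtain x where x: "norm x = 1" "\<And>j. j \<le> m \<Longrightarrow> (norm (dissipation_jet C j x))\<^sup>2 \<le> t ^ (2 * m + 2)"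
      using jets_small_if_not_coercive[OF C, of m "t ^ (2 * m + 2)"] none t by auto
    have "(norm (dissipation_jet C m x))\<^sup>2 \<le> 1"
      using x(2)[of m] power_le_one[of t "2 * m + 2"] t \<open>t \<le> 1\<close> by linarith
    then have "decay_factor m * (norm (dissipation_jet C m x))\<^sup>2 + K * t \<le> decay_factor m + K"
      using K(3) \<open>t \<le> 1\<close> t decay_factor_pos[of m]
      by (intro add_mono) (auto simp: mult_left_le)
    then have "2 * t ^ (2 * m + 1) * (decay_factor m * (norm (dissipation_jet C m x))\<^sup>2 + K * t)
        \<le> 2 * t ^ m * (decay_factor m + K)"
      using t \<open>t \<le> 1\<close> K(3) decay_factor_pos[of m]
      by (intro mult_mono mult_left_mono power_decreasing) (simp_all add: less_imp_le)
    moreover have "1 - (norm (evolution C t))\<^sup>2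
        \<le> 2 * t ^ (2 * m + 1) * (decay_factor m * (norm (dissipation_jet C m x))\<^sup>2 + K * t)"
      using t x by (intro K(4)) simp_all
    moreover have "(norm (evolution C t))\<^sup>2 \<le> norm (evolution C t)"
      using norm_evolution_le_1[OF C, of t] t by (simp add: power2_eq_square mult_left_le)
    ultimately have "1 - norm (evolution C t) \<le> 2 * t ^ m * (decay_factor m + K)"
      by linarith
    also have "\<dots> = 2 * (decay_factor m + K) * t powr m"
      using t by (simp add: powr_realpow)
    finally show ?thesis .
  qed
  have "c \<le> 2 * (decay_factor m + K) * 0"
  proof (rule tendsto_le[OF _ _ lim])
    show "((\<lambda>t. 2 * (decay_factor m + K) * t powr (m - a)) \<longlongrightarrow> 2 * (decay_factor m + K) * 0) (at_right 0)"
      using m by (intro tendsto_intros tendsto_powr_at_right_0) simp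
    have "\<forall>\<^sub>F t in at_right 0. 1 * t \<le> t0"
      by (rule eventually_at_right_mult_le) (rule K)
    with eventually_at_right_less[of "0::real"]
    show "\<forall>\<^sub>F t in at_right 0. (1 - norm (evolution C t)) / t powr a \<le> 2 * (decay_factor m + K) * t powr (m - a)"
    proof eventually_elim
      case (elim t)
      then have "(1 - norm (evolution C t)) / t powr a \<le> 2 * (decay_factor m + K) * t powr m / t powr a"
        using bound[of t] by (intro divide_right_mono) simp_all
      then show ?case
        by (simp add: powr_diff)
    qed
  qed simp
  with \<open>c > 0\<close> show False by simp
qed

lemma evolution_add: "evolution C (s + t) = evolution C s * evolution C t"
proof -
  have "s *\<^sub>R C * t *\<^sub>R C = t *\<^sub>R C * s *\<^sub>R C"
    by simp
  then show ?thesis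
    unfolding evolution_def by (subst exp_add_commuting[symmetric]) (simp_all add: scaleR_left_distrib)
qed

text \<open>
  By the semigroup law the norm decays geometrically along the multiples of \<open>t\<^sub>0\<close>, and it is at
  most \<open>1\<close> in between.
\<close>

lemma hypocoercive_if_contracting:
  assumes C: "accretive C" and t0: "t0 > 0" "norm (evolution C t0) < 1"
  shows "hypocoercive C"
proof -
  \<comment> \<open>The maximum keeps the logarithm finite if the evolution vanishes.\<close>
  define q where "q = max (1 / 2) (norm (evolution C t0))"
  have q: "0 < q" "q < 1" "norm (evolution C t0) \<le> q"
    using t0 by (auto simp: q_def)
  define \<omega> where "\<omega> = - ln q / t0"
  have "\<omega> > 0"
    using q t0 by (simp add: \<omega>_def divide_neg_pos)
  have q_eq: "q = exp (- \<omega> * t0)"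
    using q t0 by (simp add: \<omega>_def)
  have "norm (evolution C t) \<le> exp (\<omega> * t0) * exp (- \<omega> * t)" if "t \<ge> 0" for t
  proof -
    define n where "n = nat \<lfloor>t / t0\<rfloor>"
    have n: "real n \<le> t / t0" "t / t0 < real n + 1"
      using that t0 by (simp_all add: n_def)
    define r where "r = t - real n * t0"
    have r: "0 \<le> r" "r < t0"
      using n t0 by (simp_all add: r_def field_simps)
    have power: "norm (evolution C (real k * t0)) \<le> q ^ k" for k
    proof (induction k)
      case 0
      then show ?case by (simp add: evolution_0)
    next
      case (Suc k)
      have "norm (evolution C (real (Suc k) * t0)) \<le> norm (evolution C t0) * norm (evolution C (real k * t0))"
        using norm_mult_ineq[of "evolution C t0" "evolution C (real k * t0)"]
        by (simp add: distrib_right flip: evolution_add)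
      also have "\<dots> \<le> q * q ^ k"
        using Suc q by (intro mult_mono) simp_all
      finally show ?case by simp
    qed
    have "norm (evolution C t) \<le> norm (evolution C (real n * t0)) * norm (evolution C r)"
      using norm_mult_ineq[of "evolution C (real n * t0)" "evolution C r"]
      by (simp add: r_def flip: evolution_add)
    also have "\<dots> \<le> q ^ n * 1"
      using q norm_evolution_le_1[OF C r(1)] by (intro mult_mono power) simp_all
    also have "q ^ n * 1 = exp (- \<omega> * (t - r))"
      by (subst q_eq) (simp add: r_def mult_ac flip: exp_of_nat_mult)
    also have "\<dots> \<le> exp (\<omega> * t0 + - \<omega> * t)"
      using \<open>\<omega> > 0\<close> r by (simp add: algebra_simps)
    finally show ?thesis
      by (simp only: exp_add)
  qed
  with \<open>\<omega> > 0\<close> show ?thesis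
    unfolding hypocoercive_def evolution_def[symmetric] by blast
qed

lemma two_sided_bound_if_defect_tendsto:
  fixes N :: "real \<Rightarrow> real"
  assumes lim: "((\<lambda>t. (1 - N t) / t ^ a) \<longlongrightarrow> c) (at_right 0)" and "c > 0" "a > 0" "N 0 = 1"
  obtains t0 where "t0 > 0" "\<And>t. \<lbrakk>0 \<le> t; t \<le> t0\<rbrakk> \<Longrightarrow> 1 - 2 * c * t ^ a \<le> N t \<and> N t \<le> 1 - c / 2 * t ^ a"
proof -
  have "\<forall>\<^sub>F t in at_right 0. c / 2 < (1 - N t) / t ^ a" "\<forall>\<^sub>F t in at_right 0. (1 - N t) / t ^ a < 2 * c"
    using \<open>c > 0\<close> by - (rule order_tendstoD[OF lim], simp)+
  then have "\<forall>\<^sub>F t in at_right 0. c / 2 < (1 - N t) / t ^ a \<and> (1 - N t) / t ^ a < 2 * c"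
    by (rule eventually_conj)
  then obtain t1 where t1: "t1 > 0"
    "\<And>t. \<lbrakk>0 < t; t < t1\<rbrakk> \<Longrightarrow> c / 2 < (1 - N t) / t ^ a \<and> (1 - N t) / t ^ a < 2 * c"
    unfolding eventually_at_right_field by blast
  \<comment> \<open>Halving \<open>t1\<close> makes the interval closed.\<close>
  have "1 - 2 * c * t ^ a \<le> N t \<and> N t \<le> 1 - c / 2 * t ^ a" if "0 \<le> t" "t \<le> t1 / 2" for t
  proof (cases "t = 0")
    case True
    then show ?thesis
      using \<open>a > 0\<close> \<open>N 0 = 1\<close> by (simp add: power_0_left)
  next
    case False
    then have "c / 2 < (1 - N t) / t ^ a \<and> (1 - N t) / t ^ a < 2 * c" "t ^ a > 0"
      using that t1 by auto
    then show ?thesis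
      by (simp add: pos_less_divide_eq pos_divide_less_eq)
  qed
  then show ?thesis
    using that[of "t1 / 2"] \<open>t1 > 0\<close> by simp
qed

theorem theorem4p1:
  fixes C :: "'a::nonzero_complex_hilbert op"
    and P :: "real \<Rightarrow> 'a op"
  assumes separable: "separable_space (euclidean :: 'a topology)"
    and accretive: "accretive C"
    and P: "\<And>t. t \<ge> 0 \<Longrightarrow> P t = exp (- (t *\<^sub>R C))"
  shows
    "(\<forall>m a c. has_hc_index C m \<and> a = 2 * m + 1 \<and> c = hc_const C m \<longrightarrow>
        (\<exists>c1 c2 C1 C2 t0 :: real.
           c1 \<ge> c \<and> c \<ge> c2 \<and> c2 > 0 \<and> C1 \<ge> 0 \<and> C2 \<ge> 0 \<and> t0 > 0 \<and>
           (\<forall>t\<in>{0..t0}. 1 - c1 * t ^ a - C1 * t ^ (a + 1) \<le> norm (P t) \<and>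
                        norm (P t) \<le> 1 - c2 * t ^ a + C2 * t ^ (a + 1))) \<and>
        (\<lambda>t. norm (P t) - (1 - c * t ^ a)) \<in> o[at_right 0](\<lambda>t. t ^ a)) \<and>
     (\<forall>c a :: real. c > 0 \<and> a > 0 \<and>
        (\<lambda>t. norm (P t) - (1 - c * t powr a)) \<in> o[at_right 0](\<lambda>t. t powr a) \<longrightarrow>
        (\<exists>k::int. odd k \<and> a = of_int k) \<and> hypocoercive C \<and>
        (\<exists>m::nat. real m = (a - 1) / 2 \<and> has_hc_index C m))"
proof (intro conjI allI impI)
  \<comment> \<open>Only nonnegative times are specified, but limits from the right do not see any others.\<close>
  have P_eq: "P t = evolution C t" if "t \<ge> 0" for t
    using P[OF that] by (simp add: evolution_def)
  then have "\<forall>\<^sub>F t in at_right 0. (1 - norm (P t)) / g t = (1 - norm (evolution C t)) / g t" for g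
    using eventually_at_right_less[of "0::real"] by (auto elim!: eventually_mono)
  note defect_cong = tendsto_cong[OF this]
  {
    fix m a :: nat and c :: real
    assume "has_hc_index C m \<and> a = 2 * m + 1 \<and> c = hc_const C m"
    then have m: "has_hc_index C m" and a: "a = 2 * m + 1" and c: "c = hc_const C m"
      by auto
    have "c > 0"
      unfolding c by (rule evolution_defect_square_tendsto(1)[OF accretive m])
    have lim: "((\<lambda>t. (1 - norm (P t)) / t ^ a) \<longlongrightarrow> c) (at_right 0)"
      unfolding defect_cong a c by (rule evolution_defect_tendsto[OF accretive m])
    obtain t0 where "t0 > 0" "\<And>t. \<lbrakk>0 \<le> t; t \<le> t0\<rbrakk> \<Longrightarrow> 1 - 2 * c * t ^ a \<le> norm (P t) \<and> norm (P t) \<le> 1 - c / 2 * t ^ a"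
      using two_sided_bound_if_defect_tendsto[OF lim \<open>c > 0\<close>] by (auto simp: a P_eq evolution_0)
    with \<open>c > 0\<close> show "\<exists>c1 c2 C1 C2 t0 :: real.
        c1 \<ge> c \<and> c \<ge> c2 \<and> c2 > 0 \<and> C1 \<ge> 0 \<and> C2 \<ge> 0 \<and> t0 > 0 \<and>
        (\<forall>t\<in>{0..t0}. 1 - c1 * t ^ a - C1 * t ^ (a + 1) \<le> norm (P t) \<and>
                     norm (P t) \<le> 1 - c2 * t ^ a + C2 * t ^ (a + 1))"
      by (intro exI[of _ "2 * c"] exI[of _ "c / 2"] exI[of _ 0] exI[of _ t0]) auto
    show "(\<lambda>t. norm (P t) - (1 - c * t ^ a)) \<in> o[at_right 0](\<lambda>t. t ^ a)"
      using lim by (subst smallo_iff_defect_tendsto) simp_all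
  }
  {
    fix c a :: real
    assume "c > 0 \<and> a > 0 \<and> (\<lambda>t. norm (P t) - (1 - c * t powr a)) \<in> o[at_right 0](\<lambda>t. t powr a)"
    then have "c > 0" and smallo: "(\<lambda>t. norm (P t) - (1 - c * t powr a)) \<in> o[at_right 0](\<lambda>t. t powr a)"
      by auto
    have lim: "((\<lambda>t. (1 - norm (evolution C t)) / t powr a) \<longlongrightarrow> c) (at_right 0)"
      using smallo by (subst (asm) smallo_iff_defect_tendsto) (simp_all add: defect_cong)
    have "\<exists>m. hc_coercive C m"
      by (rule ex_hc_coercive[OF accretive \<open>c > 0\<close> lim])
    then obtain m where m: "has_hc_index C m"
      unfolding has_hc_index_def using exists_least_iff[of "hc_coercive C"] by blast
    have "\<forall>\<^sub>F t in at_right 0. (1 - norm (evolution C t)) / t ^ (2 * m + 1) =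
        (1 - norm (evolution C t)) / t powr real (2 * m + 1)"
      using eventually_at_right_less[of "0::real"] by eventually_elim (simp only: powr_realpow)
    from Lim_transform_eventually[OF evolution_defect_tendsto[OF accretive m] this]
    have lim': "((\<lambda>t. (1 - norm (evolution C t)) / t powr real (2 * m + 1)) \<longlongrightarrow> hc_const C m) (at_right 0)" .
    have a: "a = real (2 * m + 1)"
      using powr_order_le[OF lim _ lim'] powr_order_le[OF lim' _ lim] \<open>c > 0\<close>
        evolution_defect_square_tendsto(1)[OF accretive m] by simp
    then show "\<exists>k::int. odd k \<and> a = of_int k"
      by (intro exI[of _ "2 * int m + 1"]) simp
    show "\<exists>m::nat. real m = (a - 1) / 2 \<and> has_hc_index C m"
      using m a by (intro exI[of _ m]) simp
    have "\<forall>\<^sub>F t in at_right 0. 0 < (1 - norm (evolution C t)) / t powr a"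
      using \<open>c > 0\<close> by (rule order_tendstoD(1)[OF lim])
    then obtain t0 where "t0 > 0" "0 < (1 - norm (evolution C t0)) / t0 powr a"
      unfolding eventually_at_right_field by (metis dense)
    then show "hypocoercive C"
      by (intro hypocoercive_if_contracting[OF accretive]) (simp_all add: zero_less_divide_iff)
  }
qed

end
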